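(* Let $(G,\tau)$ be a precompact abelian group and let $\phi:(G,\tau)\to(G,\tau)$ be a continuous endomorphism. Let $\phi^\dagger:(G,\tau)^\dagger\to(G,\tau)^\dagger$ be the dual endomorphism of the precompact dual $(G,\tau)^\dagger$ of $(G,\tau)$. Then $$\mathrm{ent}^\star_\tau(\phi)=\mathrm{ent}(\phi^\dagger).$$
   Context: For an abelian group $G$, let $\mathcal C(G)$ be the family of all finite-index subgroups of $G$. For an endomorphism $\phi$ of $G$, $N\in\mathcal C(G)$ and an integer $n\ge 1$, let $B_n(\phi,N)=N\cap\phi^{-1}(N)\cap\ldots\cap\phi^{-n+1}(N)$, $C_n(\phi,N)=G/B_n(\phi,N)$ (a finite group), and $H^\star(\phi,N)=\lim_{n\to\infty}\frac{\log|C_n(\phi,N)|}{n}$ (the limit exists and is finite). For a topological abelian group $(G,\tau)$ let $\mathcal C_\tau(G)=\{N\in\mathcal C(G): N \text{ is } \tau\text{-open}\}$. The topological adjoint entropy of a continuous endomorphism $\phi:(G,\tau)\to(G,\tau)$ is $\mathrm{ent}^\star_\tau(\phi)=\sup\{H^\star(\phi,N):N\in\mathcal C_\tau(G)\}\in[0,\infty]$. For an endomorphism $\psi$ of an abelian group $A$ and a finite subgroup $F$ of $A$, let $T_n(\psi,F)=F+\psi(F)+\ldots+\psi^{n-1}(F)$ and $H(\psi,F)=\lim_{n\to\infty}\frac{\log|T_n(\psi,F)|}{n}$. The algebraic entropy of $\psi$ is $\mathrm{ent}(\psi)=\sup\{H(\psi,F): F \text{ a finite subgroup of } A\}$. A topological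 abelian group $(G,\tau)$ is totally bounded if for every open neighborhood $U$ of $0$ there is a finite $F\subseteq G$ with $U+F=G$; it is precompact if it is Hausdorff and totally bounded. The precompact dual $(G,\tau)^\dagger$ of a precompact abelian group $(G,\tau)$ is the group of all continuous homomorphisms $\chi:(G,\tau)\to\mathbb T=\mathbb R/\mathbb Z$, endowed with the topology inherited from the product topology of $\mathbb T^G$ (topology of pointwise convergence), and $\phi^\dagger(\chi)=\chi\circ\phi$. *)

theory Defs
  imports "HOL-Analysis.Analysis" "HOL-Algebra.Product_Groups"
begin

text \<open>
  Groups are records of \<^verbatim>\<open>HOL-Algebra\<close>, hence written multiplicatively: \<open>F + \<psi>(F)\<close> becomes
  \<open>F <#> \<psi> ` F\<close>. Topologies are abstract topologies on the carrier, and homomorphisms matter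
  only on the carrier. Logarithms are natural.
\<close>


section \<open>Precompact abelian groups\<close>

locale topological_abelian_group = comm_group G for G (structure) +
  fixes \<tau> :: "'a topology"
  assumes topspace_eq_carrier: "topspace \<tau> = carrier G"
    and continuous_map_mult: "continuous_map (prod_topology \<tau> \<tau>) \<tau> (\<lambda>(x, y). x \<otimes> y)"
    and continuous_map_inv: "continuous_map \<tau> \<tau> (\<lambda>x. inv x)"

definition totally_bounded_group :: "('a, 'b) monoid_scheme \<Rightarrow> 'a topology \<Rightarrow> bool" where
  "totally_bounded_group G \<tau> \<longleftrightarrow>
     (\<forall>U. openin \<tau> U \<and> \<one>\<^bsub>G\<^esub> \<in> U \<longrightarrow>
        (\<exists>F. finite F \<and> F \<subseteq> carrier G \<and> U <#>\<^bsub>G\<^esub> F = carrier G))"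

locale precompact_abelian_group = topological_abelian_group +
  assumes Hausdorff: "Hausdorff_space \<tau>"
    and totally_bounded: "totally_bounded_group G \<tau>"


section \<open>Topological adjoint entropy\<close>

definition finite_index_subgroups :: "('a, 'b) monoid_scheme \<Rightarrow> 'a set set" where
  "finite_index_subgroups G = {N. subgroup N G \<and> finite (rcosets\<^bsub>G\<^esub> N)}"

definition open_finite_index_subgroups ::
    "('a, 'b) monoid_scheme \<Rightarrow> 'a topology \<Rightarrow> 'a set set" where
  "open_finite_index_subgroups G \<tau> = {N \<in> finite_index_subgroups G. openin \<tau> N}"

definition cotrajectory ::
    "('a, 'b) monoid_scheme \<Rightarrow> ('a \<Rightarrow> 'a) \<Rightarrow> 'a set \<Rightarrow> nat \<Rightarrow> 'a set" where
  "cotrajectory G \<phi> N n = carrier G \<inter> (\<Inter>i<n. (\<phi> ^^ i) -` N)"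

text \<open>The limits below run over \<open>n \<ge> 1\<close> in effect: the term at \<open>n = 0\<close>
  does not matter.\<close>

definition adjoint_entropy_wrt ::
    "('a, 'b) monoid_scheme \<Rightarrow> ('a \<Rightarrow> 'a) \<Rightarrow> 'a set \<Rightarrow> real" where
  "adjoint_entropy_wrt G \<phi> N =
     lim (\<lambda>n. ln (real (order (G Mod cotrajectory G \<phi> N n))) / real n)"

definition topological_adjoint_entropy ::
    "('a, 'b) monoid_scheme \<Rightarrow> 'a topology \<Rightarrow> ('a \<Rightarrow> 'a) \<Rightarrow> ereal" where
  "topological_adjoint_entropy G \<tau> \<phi> =
     (SUP N \<in> open_finite_index_subgroups G \<tau>. ereal (adjoint_entropy_wrt G \<phi> N))"


section \<open>Algebraic entropy\<close>

primrec trajectory ::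
    "('a, 'b) monoid_scheme \<Rightarrow> ('a \<Rightarrow> 'a) \<Rightarrow> 'a set \<Rightarrow> nat \<Rightarrow> 'a set" where
  "trajectory A \<psi> F 0 = {\<one>\<^bsub>A\<^esub>}"
| "trajectory A \<psi> F (Suc n) = trajectory A \<psi> F n <#>\<^bsub>A\<^esub> (\<psi> ^^ n) ` F"

definition algebraic_entropy_wrt ::
    "('a, 'b) monoid_scheme \<Rightarrow> ('a \<Rightarrow> 'a) \<Rightarrow> 'a set \<Rightarrow> real" where
  "algebraic_entropy_wrt A \<psi> F = lim (\<lambda>n. ln (real (card (trajectory A \<psi> F n))) / real n)"

definition algebraic_entropy :: "('a, 'b) monoid_scheme \<Rightarrow> ('a \<Rightarrow> 'a) \<Rightarrow> ereal" where
  "algebraic_entropy A \<psi> =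
     (SUP F \<in> {F. subgroup F A \<and> finite F}. ereal (algebraic_entropy_wrt A \<psi> F))"


section \<open>The circle group\<close>

definition real_group :: "real monoid" where
  "real_group = \<lparr>carrier = UNIV, monoid.mult = (+), one = 0\<rparr>"

definition circle_group :: "real set monoid" where
  "circle_group = real_group Mod \<int>"

text \<open>The quotient topology of \<open>\<real> / \<int>\<close>; see \<open>quotient_map_circle\<close> below.\<close>

definition circle_topology :: "real set topology" where
  "circle_topology =
     topology (\<lambda>U. U \<subseteq> carrier circle_group \<and> open {x. \<int> #>\<^bsub>real_group\<^esub> x \<in> U})"

lemma real_group_simps [simp]:
  "carrier real_group = UNIV" "x \<otimes>\<^bsub>real_group\<^esub> y = x + y" "\<one>\<^bsub>real_group\<^esub> = 0"
  by (simp_all add: real_group_def)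

lemma comm_group_real_group: "comm_group real_group"
proof (rule comm_groupI)
  show "\<exists>y\<in>carrier real_group. y \<otimes>\<^bsub>real_group\<^esub> x = \<one>\<^bsub>real_group\<^esub>" for x
    by (rule bexI [of _ "- x"]) simp_all
qed simp_all

lemma subgroup_Ints: "subgroup \<int> real_group"
proof -
  interpret comm_group real_group by (rule comm_group_real_group)
  have "inv\<^bsub>real_group\<^esub> x = - x" for x
    by (rule inv_equality) auto
  then show ?thesis
    by unfold_locales auto
qed

lemma normal_Ints: "\<int> \<lhd> real_group"
  by (simp add: comm_group.normal_iff_subgroup comm_group_real_group subgroup_Ints)

lemma comm_group_circle_group: "comm_group circle_group"
  unfolding circle_group_def
  by (rule comm_group.abelian_FactGroup [OF comm_group_real_group subgroup_Ints])

lemma carrier_circle_group: "carrier circle_group = range (\<lambda>x. \<int> #>\<^bsub>real_group\<^esub> x)"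
  by (simp add: circle_group_def carrier_FactGroup)

lemma mult_circle_group:
  "(\<int> #>\<^bsub>real_group\<^esub> x) \<otimes>\<^bsub>circle_group\<^esub> (\<int> #>\<^bsub>real_group\<^esub> y) = \<int> #>\<^bsub>real_group\<^esub> (x + y)"
  using normal.rcos_sum [OF normal_Ints, of x y] by (simp add: circle_group_def)

lemma openin_circle_topology:
  "openin circle_topology U \<longleftrightarrow>
     U \<subseteq> carrier circle_group \<and> open {x. \<int> #>\<^bsub>real_group\<^esub> x \<in> U}"
proof -
  have "istopology (\<lambda>U. U \<subseteq> carrier circle_group \<and> open {x. \<int> #>\<^bsub>real_group\<^esub> x \<in> U})"
    unfolding istopology_def
  proof (intro conjI allI impI)
    fix S T
    assume S: "S \<subseteq> carrier circle_group \<and> open {x. \<int> #>\<^bsub>real_group\<^esub> x \<in> S}"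
      and T: "T \<subseteq> carrier circle_group \<and> open {x. \<int> #>\<^bsub>real_group\<^esub> x \<in> T}"
    then show "S \<inter> T \<subseteq> carrier circle_group" by auto
    show "open {x. \<int> #>\<^bsub>real_group\<^esub> x \<in> S \<inter> T}"
      using S T by (simp add: open_Collect_conj)
  next
    fix \<K> :: "real set set set"
    assume K: "\<forall>K\<in>\<K>. K \<subseteq> carrier circle_group \<and> open {x. \<int> #>\<^bsub>real_group\<^esub> x \<in> K}"
    then show "\<Union>\<K> \<subseteq> carrier circle_group" by auto
    have "{x. \<int> #>\<^bsub>real_group\<^esub> x \<in> \<Union>\<K>} = (\<Union>K\<in>\<K>. {x. \<int> #>\<^bsub>real_group\<^esub> x \<in> K})"
      by auto
    then show "open {x. \<int> #>\<^bsub>real_group\<^esub> x \<in> \<Union>\<K>}"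
      using K by (metis (no_types, lifting) open_UN)
  qed
  then show ?thesis
    by (simp add: circle_topology_def)
qed

lemma topspace_circle_topology: "topspace circle_topology = carrier circle_group"
proof
  show "topspace circle_topology \<subseteq> carrier circle_group"
    using openin_circle_topology openin_topspace by blast
  have "openin circle_topology (carrier circle_group)"
    by (simp add: openin_circle_topology carrier_circle_group)
  then show "carrier circle_group \<subseteq> topspace circle_topology"
    by (rule openin_subset)
qed

lemma quotient_map_circle:
  "quotient_map euclideanreal circle_topology (\<lambda>x. \<int> #>\<^bsub>real_group\<^esub> x)"
  unfolding quotient_map_def topspace_circle_topology
  by (simp add: carrier_circle_group openin_circle_topology)

lemma circle_coset_eq_iff: "\<int> #>\<^bsub>real_group\<^esub> x = \<int> #>\<^bsub>real_group\<^esub> y \<longleftrightarrow> x - y \<in> \<int>"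
proof
  assume "\<int> #>\<^bsub>real_group\<^esub> x = \<int> #>\<^bsub>real_group\<^esub> y"
  moreover have "x \<in> \<int> #>\<^bsub>real_group\<^esub> x"
    by (auto simp: r_coset_def intro!: bexI [of _ 0])
  ultimately have "x \<in> \<int> #>\<^bsub>real_group\<^esub> y" by simp
  then show "x - y \<in> \<int>"
    by (auto simp: r_coset_def)
next
  assume *: "x - y \<in> \<int>"
  have "\<exists>k\<in>\<int>. h + x = k + y" "\<exists>k\<in>\<int>. h + y = k + x" if "h \<in> \<int>" for h
  proof -
    show "\<exists>k\<in>\<int>. h + x = k + y"
      by (rule bexI [OF _ Ints_add [OF that *]]) simp
    show "\<exists>k\<in>\<int>. h + y = k + x"
      by (rule bexI [OF _ Ints_diff [OF that *]]) simp
  qed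
  then show "\<int> #>\<^bsub>real_group\<^esub> x = \<int> #>\<^bsub>real_group\<^esub> y"
    by (auto simp: r_coset_def)
qed

lemma open_map_circle:
  "open_map euclideanreal circle_topology (\<lambda>x. \<int> #>\<^bsub>real_group\<^esub> x)"
  unfolding open_map_def
proof (intro allI impI)
  fix V :: "real set"
  assume "openin euclideanreal V"
  then have V: "open V" by simp
  have "{x. \<int> #>\<^bsub>real_group\<^esub> x \<in> (\<lambda>x. \<int> #>\<^bsub>real_group\<^esub> x) ` V} = (\<Union>k\<in>\<int>. (+) k ` V)"
  proof (intro Set.set_eqI iffI)
    fix x
    assume "x \<in> {x. \<int> #>\<^bsub>real_group\<^esub> x \<in> (\<lambda>x. \<int> #>\<^bsub>real_group\<^esub> x) ` V}"
    then obtain v where "v \<in> V" "x - v \<in> \<int>"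
      by (auto simp: circle_coset_eq_iff)
    then show "x \<in> (\<Union>k\<in>\<int>. (+) k ` V)"
      by (intro UN_I [of "x - v"]) auto
  next
    fix x
    assume "x \<in> (\<Union>k\<in>\<int>. (+) k ` V)"
    then obtain k v where "k \<in> \<int>" "v \<in> V" "x = k + v" by auto
    then have "\<int> #>\<^bsub>real_group\<^esub> x = \<int> #>\<^bsub>real_group\<^esub> v" "v \<in> V"
      by (simp_all add: circle_coset_eq_iff)
    then show "x \<in> {x. \<int> #>\<^bsub>real_group\<^esub> x \<in> (\<lambda>x. \<int> #>\<^bsub>real_group\<^esub> x) ` V}"
      by blast
  qed
  then show "openin circle_topology ((\<lambda>x. \<int> #>\<^bsub>real_group\<^esub> x) ` V)"
    using V by (auto simp: openin_circle_topology carrier_circle_group intro: open_translation)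
qed

lemma topological_abelian_group_circle:
  "topological_abelian_group circle_group circle_topology"
proof -
  let ?p = "\<lambda>x. \<int> #>\<^bsub>real_group\<^esub> x"
  interpret comm_group circle_group by (rule comm_group_circle_group)
  have one: "\<one>\<^bsub>circle_group\<^esub> = ?p 0"
    using circle_group_def one_FactGroup
    by (metis comm_group_real_group group.coset_mult_one comm_group_def real_group_simps(1,3)
        subset_UNIV)
  have inv: "inv\<^bsub>circle_group\<^esub> ?p x = ?p (- x)" for x
    by (rule inv_equality) (auto simp: mult_circle_group one carrier_circle_group)
  show ?thesis
  proof unfold_locales
    show "topspace circle_topology = carrier circle_group"
      by (rule topspace_circle_topology)
    show "continuous_map (prod_topology circle_topology circle_topology) circle_topology
            (\<lambda>(x, y). x \<otimes>\<^bsub>circle_group\<^esub> y)"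
      unfolding continuous_map
    proof (intro conjI allI impI)
      show "(\<lambda>(x, y). x \<otimes>\<^bsub>circle_group\<^esub> y) ` topspace (prod_topology circle_topology circle_topology)
              \<subseteq> topspace circle_topology"
        by (auto simp: topspace_circle_topology)
      fix U
      assume U: "openin circle_topology U"
      let ?W = "{z \<in> topspace (prod_topology circle_topology circle_topology).
                   (case z of (x, y) \<Rightarrow> x \<otimes>\<^bsub>circle_group\<^esub> y) \<in> U}"
      show "openin (prod_topology circle_topology circle_topology) ?W"
        unfolding openin_prod_topology_alt
      proof (intro allI impI)
        fix a b
        assume "(a, b) \<in> ?W"
        then obtain x y where ab: "a = ?p x" "b = ?p y" and "?p (x + y) \<in> U"
          by (auto simp: topspace_circle_topology carrier_circle_group mult_circle_group)
        moreover have "open ((\<lambda>(s, t). s + t) -` {x. ?p x \<in> U})"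
          using U by (intro open_vimage)
            (auto simp: openin_circle_topology case_prod_unfold intro!: continuous_intros)
        ultimately obtain V W where VW: "open V" "open W" "x \<in> V" "y \<in> W"
            "V \<times> W \<subseteq> (\<lambda>(s, t). s + t) -` {x. ?p x \<in> U}"
          by (elim open_prod_elim [of _ "(x, y)"]) auto
        have "openin circle_topology (?p ` V)" "openin circle_topology (?p ` W)"
          using VW open_map_circle by (auto simp: open_map_def)
        moreover have "?p ` V \<times> ?p ` W \<subseteq> ?W"
          using VW by (fastforce simp: topspace_circle_topology carrier_circle_group mult_circle_group)
        ultimately show "\<exists>V W. openin circle_topology V \<and> openin circle_topology W \<and>
            a \<in> V \<and> b \<in> W \<and> V \<times> W \<subseteq> ?W"
          using VW ab by blast
      qed
    qed
    have "continuous_map euclideanreal circle_topology (?p \<circ> uminus)"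
      by (rule continuous_map_compose [OF _ quotient_imp_continuous_map [OF quotient_map_circle]])
        (auto intro!: continuous_intros)
    then have "continuous_map euclideanreal circle_topology ((\<lambda>x. inv\<^bsub>circle_group\<^esub> x) \<circ> ?p)"
      by (simp add: o_def inv)
    then show "continuous_map circle_topology circle_topology (\<lambda>x. inv\<^bsub>circle_group\<^esub> x)"
      by (rule continuous_compose_quotient_map [OF quotient_map_circle])
  qed
qed


section \<open>The precompact dual\<close>

text \<open>Characters are made \<^const>\<open>extensional\<close> on the carrier so that each is represented once, as
  in \<^const>\<open>product_group\<close>; pointwise multiplication and the topology of pointwise convergence
  are inherited from the full power of the circle.\<close>

definition continuous_characters ::
    "('a, 'b) monoid_scheme \<Rightarrow> 'a topology \<Rightarrow> ('a \<Rightarrow> real set) set" where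
  "continuous_characters G \<tau> =
     {\<xi> \<in> hom G circle_group \<inter> extensional (carrier G). continuous_map \<tau> circle_topology \<xi>}"

definition precompact_dual ::
    "('a, 'b) monoid_scheme \<Rightarrow> 'a topology \<Rightarrow> ('a \<Rightarrow> real set) monoid" where
  "precompact_dual G \<tau> =
     (product_group (carrier G) (\<lambda>_. circle_group)) \<lparr>carrier := continuous_characters G \<tau>\<rparr>"

text \<open>The algebraic entropy depends on the dual only as an abstract group; its topology is recorded
  for completeness.\<close>

definition precompact_dual_topology ::
    "('a, 'b) monoid_scheme \<Rightarrow> 'a topology \<Rightarrow> ('a \<Rightarrow> real set) topology" where
  "precompact_dual_topology G \<tau> =
     subtopology (product_topology (\<lambda>_. circle_topology) (carrier G)) (continuous_characters G \<tau>)"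

definition dual_endomorphism ::
    "('a, 'b) monoid_scheme \<Rightarrow> ('a \<Rightarrow> 'a) \<Rightarrow> ('a \<Rightarrow> real set) \<Rightarrow> ('a \<Rightarrow> real set)" where
  "dual_endomorphism G \<phi> \<xi> = compose (carrier G) \<xi> \<phi>"

context topological_abelian_group
begin

lemma comm_group_precompact_dual: "comm_group (precompact_dual G \<tau>)"
proof -
  let ?P = "product_group (carrier G) (\<lambda>_. circle_group)"
  interpret T: topological_abelian_group circle_group circle_topology
    by (rule topological_abelian_group_circle)
  interpret P: comm_group ?P
    by (rule group.group_comm_groupI)
      (auto intro!: restrict_ext simp: PiE_iff T.m_comm)
  have sub: "subgroup (continuous_characters G \<tau>) ?P"
  proof (rule P.subgroupI)
    show "continuous_characters G \<tau> \<subseteq> carrier ?P"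
      by (auto simp: continuous_characters_def hom_def PiE_def)
    have "continuous_map \<tau> circle_topology (\<lambda>x. \<one>\<^bsub>circle_group\<^esub>)"
      by (simp add: T.topspace_eq_carrier)
    then have "continuous_map \<tau> circle_topology (\<lambda>x\<in>carrier G. \<one>\<^bsub>circle_group\<^esub>)"
      by (rule continuous_map_eq) (simp add: topspace_eq_carrier)
    then have "(\<lambda>x\<in>carrier G. \<one>\<^bsub>circle_group\<^esub>) \<in> continuous_characters G \<tau>"
      by (auto simp: continuous_characters_def hom_def)
    then show "continuous_characters G \<tau> \<noteq> {}" by blast
  next
    fix a assume a: "a \<in> continuous_characters G \<tau>"
    then have c: "a x \<in> carrier circle_group" if "x \<in> carrier G" for x
      using that by (auto simp: continuous_characters_def hom_def)
    have "continuous_map \<tau> circle_topology (\<lambda>x. inv\<^bsub>circle_group\<^esub> a x)"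
      using continuous_map_compose [OF _ T.continuous_map_inv, of \<tau> a] a
      by (simp add: continuous_characters_def o_def)
    then have "continuous_map \<tau> circle_topology (\<lambda>x\<in>carrier G. inv\<^bsub>circle_group\<^esub> a x)"
      by (rule continuous_map_eq) (simp add: topspace_eq_carrier)
    moreover have "(\<lambda>x\<in>carrier G. inv\<^bsub>circle_group\<^esub> a x) \<in> hom G circle_group"
      using a c by (auto simp: continuous_characters_def hom_def T.inv_mult)
    moreover have "a \<in> (\<Pi>\<^sub>E i\<in>carrier G. carrier circle_group)"
      using a by (auto simp: continuous_characters_def hom_def PiE_def)
    ultimately show "inv\<^bsub>?P\<^esub> a \<in> continuous_characters G \<tau>"
      by (simp add: continuous_characters_def)
  next
    fix a b assume ab: "a \<in> continuous_characters G \<tau>" "b \<in> continuous_characters G \<tau>"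
    then have c: "a x \<in> carrier circle_group" "b x \<in> carrier circle_group" if "x \<in> carrier G" for x
      using that by (auto simp: continuous_characters_def hom_def)
    have "continuous_map \<tau> (prod_topology circle_topology circle_topology) (\<lambda>x. (a x, b x))"
      using ab by (simp add: continuous_characters_def continuous_map_paired)
    from continuous_map_compose [OF this T.continuous_map_mult]
    have "continuous_map \<tau> circle_topology (\<lambda>x. a x \<otimes>\<^bsub>circle_group\<^esub> b x)"
      by (simp add: o_def)
    then have "continuous_map \<tau> circle_topology (\<lambda>x\<in>carrier G. a x \<otimes>\<^bsub>circle_group\<^esub> b x)"
      by (rule continuous_map_eq) (simp add: topspace_eq_carrier)
    moreover have "(\<lambda>x\<in>carrier G. a x \<otimes>\<^bsub>circle_group\<^esub> b x) \<in> hom G circle_group"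
      using ab c by (auto simp: continuous_characters_def hom_def T.m_ac)
    ultimately show "a \<otimes>\<^bsub>?P\<^esub> b \<in> continuous_characters G \<tau>"
      by (simp add: continuous_characters_def)
  qed
  show ?thesis
    unfolding precompact_dual_def
  proof (rule group.group_comm_groupI [OF P.subgroup_imp_group [OF sub]])
    fix a b
    assume "a \<in> carrier (?P\<lparr>carrier := continuous_characters G \<tau>\<rparr>)"
      "b \<in> carrier (?P\<lparr>carrier := continuous_characters G \<tau>\<rparr>)"
    then have "a \<in> carrier ?P" "b \<in> carrier ?P"
      using subgroup.subset [OF sub] by auto
    from P.m_comm [OF this]
    show "a \<otimes>\<^bsub>?P\<lparr>carrier := continuous_characters G \<tau>\<rparr>\<^esub> b =
          b \<otimes>\<^bsub>?P\<lparr>carrier := continuous_characters G \<tau>\<rparr>\<^esub> a"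
      by simp
  qed
qed

lemma dual_endomorphism_hom:
  assumes "\<phi> \<in> hom G G" "continuous_map \<tau> \<tau> \<phi>"
  shows "dual_endomorphism G \<phi> \<in> hom (precompact_dual G \<tau>) (precompact_dual G \<tau>)"
proof (rule homI)
  fix \<xi> assume "\<xi> \<in> carrier (precompact_dual G \<tau>)"
  then have \<xi>: "\<xi> \<in> hom G circle_group" "continuous_map \<tau> circle_topology \<xi>"
    by (auto simp: precompact_dual_def continuous_characters_def)
  have "continuous_map \<tau> circle_topology (compose (carrier G) \<xi> \<phi>)"
    using continuous_map_compose [OF assms(2) \<xi>(2)]
    by (rule continuous_map_eq) (simp add: compose_def topspace_eq_carrier)
  moreover have "compose (carrier G) \<xi> \<phi> \<in> hom G circle_group"
    using hom_compose [OF assms(1) \<xi>(1)] by (auto simp: hom_def compose_def)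
  ultimately show "dual_endomorphism G \<phi> \<xi> \<in> carrier (precompact_dual G \<tau>)"
    by (simp add: dual_endomorphism_def precompact_dual_def continuous_characters_def)
next
  fix \<xi> \<psi>
  have "\<phi> x \<in> carrier G" if "x \<in> carrier G" for x
    using assms(1) that by (auto simp: hom_def)
  then show "dual_endomorphism G \<phi> (\<xi> \<otimes>\<^bsub>precompact_dual G \<tau>\<^esub> \<psi>) =
        dual_endomorphism G \<phi> \<xi> \<otimes>\<^bsub>precompact_dual G \<tau>\<^esub> dual_endomorphism G \<phi> \<psi>"
    by (simp add: dual_endomorphism_def precompact_dual_def compose_def cong: restrict_cong)
qed

lemma continuous_map_dual_endomorphism:
  assumes "\<phi> \<in> hom G G" "continuous_map \<tau> \<tau> \<phi>"
  shows "continuous_map (precompact_dual_topology G \<tau>) (precompact_dual_topology G \<tau>)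
           (dual_endomorphism G \<phi>)"
proof -
  let ?X = "product_topology (\<lambda>_. circle_topology) (carrier G)"
  have \<phi>: "\<phi> x \<in> carrier G" if "x \<in> carrier G" for x
    using assms(1) that by (auto simp: hom_def)
  have "continuous_map ?X ?X (dual_endomorphism G \<phi>)"
    unfolding continuous_map_componentwise
  proof (intro conjI ballI)
    show "dual_endomorphism G \<phi> ` topspace ?X \<subseteq> extensional (carrier G)"
      by (auto simp: dual_endomorphism_def)
    fix x assume "x \<in> carrier G"
    then show "continuous_map ?X circle_topology (\<lambda>\<xi>. dual_endomorphism G \<phi> \<xi> x)"
      using \<phi> continuous_map_product_projection [of "\<phi> x" "carrier G" "\<lambda>_. circle_topology"]
      by (simp add: dual_endomorphism_def compose_def)
  qed
  moreover have "dual_endomorphism G \<phi> \<in> continuous_characters G \<tau> \<rightarrow> continuous_characters G \<tau>"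
    using dual_endomorphism_hom [OF assms] by (auto simp: hom_def precompact_dual_def)
  ultimately show ?thesis
    unfolding precompact_dual_topology_def
    by (auto simp: continuous_map_in_subtopology intro: continuous_map_from_subtopology)
qed

end

end

theory Submission
  imports Defs "HOL-Algebra.Multiplicative_Group"
begin

text \<open>
  For a finite group \<open>F\<close> of characters with annihilator \<open>N\<close>, summing all values \<open>\<xi>(a)\<close> over \<open>\<xi> \<in> F\<close>
  and \<open>a \<in> G / N\<close> in either order gives \<open>|F| = |G / N|\<close>. Conversely every open subgroup \<open>N\<close> of
  finite index is the annihilator of its finite group of annihilating characters, because
  homomorphisms into the divisible circle extend and hence separate points of \<open>G / N\<close> from \<open>0\<close>.
  Since the annihilator of a sum is the intersection of the annihilators, the trajectory
  \<open>T\<^sub>n(\<phi>\<^sup>\<dagger>, F)\<close> has annihilator \<open>B\<^sub>n(\<phi>, N)\<close>, so \<open>|T\<^sub>n(\<phi>\<^sup>\<dagger>, F)| = |C\<^sub>n(\<phi>, N)|\<close> for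
  every \<open>n\<close> and the two suprema run over the same numbers.
\<close>

section \<open>Extending homomorphisms\<close>

text \<open>The exponents \<open>k\<close> with \<open>x [^] k \<in> H\<close> form a subgroup of
  the integers, generated by the order of the coset \<open>H #> x\<close> in the quotient. The
  generator \<open>m\<close> is \<open>0\<close> when that order is infinite.\<close>

lemma (in normal) int_pow_mem_iff_dvd:
  assumes "x \<in> carrier G"
  shows "\<exists>m::nat. \<forall>k::int. x [^] k \<in> H \<longleftrightarrow> int m dvd k"
proof -
  interpret Q: group "G Mod H" by (rule factorgroup_is_group)
  have "x [^] k \<in> H \<longleftrightarrow> int (Q.ord (H #> x)) dvd k" for k :: int
  proof -
    have "x [^] k \<in> H \<longleftrightarrow> H #> (x [^] k) = H"
      using assms coset_join1 coset_join2 is_subgroup subset by (metis int_pow_closed)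
    also have "\<dots> \<longleftrightarrow> (H #> x) [^]\<^bsub>G Mod H\<^esub> k = \<one>\<^bsub>G Mod H\<^esub>"
      using FactGroup_int_pow [OF assms, of k] by simp
    also have "\<dots> \<longleftrightarrow> int (Q.ord (H #> x)) dvd k"
      by (rule Q.int_pow_eq_id) (use assms in \<open>auto simp: carrier_FactGroup\<close>)
    finally show ?thesis .
  qed
  then show ?thesis by blast
qed

text \<open>The only possible extension sends \<open>h \<otimes> x [^] k\<close> to
  \<open>\<xi> h\<close> times the \<open>k\<close>-th power of \<open>t\<close>. Two such
  representations of an element differ by a power of \<open>x\<close> lying in \<open>H\<close>,
  whose exponent is a multiple of \<open>m\<close> by assumption \<open>m\<close>; there
  \<open>tm\<close> forces the two recipes to agree.\<close>

lemma (in comm_group) extend_hom_by_element: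
  assumes H: "subgroup H G" and "comm_group C"
    and \<xi>: "\<xi> \<in> hom (G\<lparr>carrier := H\<rparr>) C"
    and x: "x \<in> carrier G" and t: "t \<in> carrier C"
    and m: "\<And>k::int. x [^] k \<in> H \<longleftrightarrow> int m dvd k"
    and tm: "\<xi> (x [^] m) = t [^]\<^bsub>C\<^esub> m"
  obtains K \<eta> where "subgroup K G" "H \<subseteq> K" "x \<in> K" "\<eta> \<in> hom (G\<lparr>carrier := K\<rparr>) C"
    "\<And>h. h \<in> H \<Longrightarrow> \<eta> h = \<xi> h" "\<eta> x = t"
proof -
  interpret C: comm_group C by fact
  interpret H: subgroup H G by fact
  interpret \<xi>: group_hom "G\<lparr>carrier := H\<rparr>" C \<xi>
    using \<xi> H.subgroup_is_group [OF group_axioms]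
    by (simp add: group_hom_def group_hom_axioms_def C.group_axioms)
  have \<xi>_mult: "\<xi> (g \<otimes> h) = \<xi> g \<otimes>\<^bsub>C\<^esub> \<xi> h" if "g \<in> H" "h \<in> H" for g h
    using \<xi>.hom_mult that by simp
  have \<xi>_closed: "\<xi> h \<in> carrier C" if "h \<in> H" for h
    using \<xi>.hom_closed that by simp
  \<comment> \<open>The compatibility \<open>tm\<close> at exponent \<open>m\<close> spreads to all
    integer multiples of \<open>m\<close>, that is, to all powers of \<open>x\<close> inside
    \<open>H\<close>.\<close>
  have \<xi>_pow: "\<xi> (x [^] (int m * j)) = t [^]\<^bsub>C\<^esub> (int m * j)" for j
  proof -
    have xm: "x [^] m \<in> H"
      using m [of "int m"] by (simp add: int_pow_int)
    have "\<xi> (x [^] (int m * j)) = \<xi> ((x [^] m) [^] j)"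
      using x by (simp add: int_pow_pow flip: int_pow_int)
    also have "\<dots> = \<xi> ((x [^] m) [^]\<^bsub>G\<lparr>carrier := H\<rparr>\<^esub> j)"
      using int_pow_consistent [OF H xm] by simp
    also have "\<dots> = (t [^]\<^bsub>C\<^esub> m) [^]\<^bsub>C\<^esub> j"
      using \<xi>.hom_int_pow [of "x [^] m" j] xm by (simp add: tm)
    finally show ?thesis
      using t by (simp add: C.int_pow_pow flip: int_pow_int)
  qed
  \<comment> \<open>Well-definedness of the extension: \<open>x [^] (l - k)\<close> lies in
    \<open>H\<close>, so \<open>\<xi>_pow\<close> evaluates it.\<close>
  have unique: "\<xi> h \<otimes>\<^bsub>C\<^esub> t [^]\<^bsub>C\<^esub> k = \<xi> h' \<otimes>\<^bsub>C\<^esub> t [^]\<^bsub>C\<^esub> l"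
    if h: "h \<in> H" "h' \<in> H" and eq: "h \<otimes> x [^] k = h' \<otimes> x [^] l" for h h' and k l :: int
  proof -
    have h_eq: "h = h' \<otimes> x [^] (l - k)"
      using eq h x by (metis H.mem_carrier int_pow_closed int_pow_diff inv_solve_right' m_assoc
          inv_closed m_closed)
    then have "x [^] (l - k) = inv h' \<otimes> h"
      using h x by (simp add: inv_solve_left)
    then have mem: "x [^] (l - k) \<in> H"
      using h by simp
    then obtain j where j: "l - k = int m * j"
      using m by (auto elim: dvdE)
    have "\<xi> h = \<xi> h' \<otimes>\<^bsub>C\<^esub> t [^]\<^bsub>C\<^esub> (l - k)"
      using h_eq h mem \<xi>_mult \<xi>_pow [of j] j by metis
    then have "\<xi> h \<otimes>\<^bsub>C\<^esub> t [^]\<^bsub>C\<^esub> k = \<xi> h' \<otimes>\<^bsub>C\<^esub> (t [^]\<^bsub>C\<^esub> (l - k) \<otimes>\<^bsub>C\<^esub> t [^]\<^bsub>C\<^esub> k)"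
      using h t by (simp add: C.m_assoc \<xi>_closed)
    also have "t [^]\<^bsub>C\<^esub> (l - k) \<otimes>\<^bsub>C\<^esub> t [^]\<^bsub>C\<^esub> k = t [^]\<^bsub>C\<^esub> l"
      using t by (simp flip: C.int_pow_mult)
    finally show ?thesis .
  qed
  \<comment> \<open>\<open>K\<close> is the subgroup generated by \<open>H\<close> and
    \<open>x\<close>. The description operator in \<open>\<eta>\<close> picks the value common to
    all representations, which \<open>unique\<close> guarantees.\<close>
  define K where "K = {h \<otimes> x [^] k |h k. h \<in> H \<and> k \<in> (UNIV :: int set)}"
  define \<eta> where
    "\<eta> y = (THE c. \<exists>h\<in>H. \<exists>k::int. y = h \<otimes> x [^] k \<and> c = \<xi> h \<otimes>\<^bsub>C\<^esub> t [^]\<^bsub>C\<^esub> k)" for y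
  have \<eta>_eq: "\<eta> (h \<otimes> x [^] k) = \<xi> h \<otimes>\<^bsub>C\<^esub> t [^]\<^bsub>C\<^esub> k" if "h \<in> H" for h and k :: int
    unfolding \<eta>_def
  proof (rule the_equality)
    show "\<exists>h'\<in>H. \<exists>l::int. h \<otimes> x [^] k = h' \<otimes> x [^] l \<and>
        \<xi> h \<otimes>\<^bsub>C\<^esub> t [^]\<^bsub>C\<^esub> k = \<xi> h' \<otimes>\<^bsub>C\<^esub> t [^]\<^bsub>C\<^esub> l"
      using that by auto
  qed (use unique [OF that] in metis)
  have mult: "(h \<otimes> x [^] k) \<otimes> (h' \<otimes> x [^] l) = (h \<otimes> h') \<otimes> x [^] (k + l)"
    if "h \<in> H" "h' \<in> H" for h h' and k l :: int
    using that x by (simp add: m_ac int_pow_mult)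
  have K_memI: "h \<otimes> x [^] k \<in> K" if "h \<in> H" for h and k :: int
    using that by (auto simp: K_def)
  show thesis
  proof
    show "subgroup K G"
    proof (rule subgroupI)
      show "K \<subseteq> carrier G" "K \<noteq> {}"
        using x K_memI [OF H.one_closed, of 0] by (auto simp: K_def)
      fix y assume "y \<in> K"
      then obtain h and k :: int where h: "h \<in> H" "y = h \<otimes> x [^] k"
        by (auto simp: K_def)
      then have "inv y = inv h \<otimes> x [^] (- k)"
        using x by (simp add: inv_mult int_pow_neg)
      then show "inv y \<in> K"
        using K_memI [of "inv h" "- k"] h by simp
      fix z assume "z \<in> K"
      then obtain h' and l :: int where "h' \<in> H" "z = h' \<otimes> x [^] l"
        by (auto simp: K_def)
      then show "y \<otimes> z \<in> K"
        using h mult K_memI by simp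
    qed
    show "H \<subseteq> K"
      using K_memI [where k = 0] by fastforce
    show "x \<in> K"
      using K_memI [of \<one> 1] x by simp
    show "\<eta> \<in> hom (G\<lparr>carrier := K\<rparr>) C"
    proof (rule homI)
      fix y assume "y \<in> carrier (G\<lparr>carrier := K\<rparr>)"
      then obtain h and k :: int where h: "h \<in> H" "y = h \<otimes> x [^] k"
        by (auto simp: K_def)
      then show "\<eta> y \<in> carrier C"
        using t by (simp add: \<eta>_eq \<xi>_closed)
      fix z assume "z \<in> carrier (G\<lparr>carrier := K\<rparr>)"
      then obtain h' and l :: int where "h' \<in> H" "z = h' \<otimes> x [^] l"
        by (auto simp: K_def)
      then show "\<eta> (y \<otimes>\<^bsub>G\<lparr>carrier := K\<rparr>\<^esub> z) = \<eta> y \<otimes>\<^bsub>C\<^esub> \<eta> z"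
        using h t by (simp add: mult \<eta>_eq \<xi>_mult \<xi>_closed C.m_ac C.int_pow_mult)
    qed
    show "\<eta> h = \<xi> h" if "h \<in> H" for h
      using \<eta>_eq [OF that, of 0] that by (simp add: \<xi>_closed)
    show "\<eta> x = t"
      using \<eta>_eq [of \<one> 1] x t \<xi>.hom_one by simp
  qed
qed

text \<open>A subgroup containing \<open>N\<close> is the union of the cosets of \<open>N\<close>
  that it meets, so it is determined by a subset of the finite set of cosets.\<close>

lemma (in comm_group) finite_overgroups_of_finite_index:
  assumes N: "subgroup N G" and fin: "finite (rcosets N)"
  shows "finite {H. subgroup H G \<and> N \<subseteq> H}"
proof (rule finite_subset)
  show "{H. subgroup H G \<and> N \<subseteq> H} \<subseteq> Union ` Pow (rcosets N)"
  proof safe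
    fix H assume H: "subgroup H G" "N \<subseteq> H"
    have "H = \<Union>((\<lambda>h. N #> h) ` H)"
    proof safe
      fix h assume "h \<in> H"
      then show "h \<in> \<Union>((\<lambda>h. N #> h) ` H)"
        using rcos_self [OF _ N] H by (auto dest: subgroup.mem_carrier)
    next
      fix h y assume "h \<in> H" "y \<in> N #> h"
      then show "y \<in> H"
        using H by (auto simp: r_coset_def intro: subgroup.m_closed)
    qed
    moreover have "(\<lambda>h. N #> h) ` H \<subseteq> rcosets N"
      using subgroup.subset [OF H(1)] by (auto simp: RCOSETS_def)
    ultimately show "H \<in> Union ` Pow (rcosets N)" by blast
  qed
  show "finite (Union ` Pow (rcosets N))"
    using fin by simp
qed

text \<open>Lagrange's theorem in the quotient \<open>G Mod N\<close>, whose order is the index of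
  \<open>N\<close>.\<close>

lemma (in comm_group) pow_index_mem:
  assumes N: "subgroup N G" and fin: "finite (rcosets N)" and x: "x \<in> carrier G"
  shows "x [^] card (rcosets N) \<in> N"
proof -
  have "N \<lhd> G" using N by (simp add: normal_iff_subgroup)
  then interpret N: normal N G .
  interpret Q: group "G Mod N" by (rule N.factorgroup_is_group)
  have "(N #> x) [^]\<^bsub>G Mod N\<^esub> order (G Mod N) = \<one>\<^bsub>G Mod N\<^esub>"
    by (rule Q.pow_order_eq_1) (use x in \<open>auto simp: carrier_FactGroup\<close>)
  then have "N #> (x [^] card (rcosets N)) = N"
    using N.FactGroup_pow [OF x] by (simp add: order_def FactGroup_def)
  then show ?thesis
    using N x by (metis coset_join1 nat_pow_closed subgroup.subset)
qed

text \<open>Start with the trivial homomorphism on \<open>N\<close>, give it a nontrivial value at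
  \<open>a\<close> by \<open>torsion\<close>, then extend one element at a time by
  \<open>divisible\<close>. Finite index leaves only finitely many subgroups above \<open>N\<close>,
  so a maximal domain exists without Zorn's lemma.\<close>

lemma (in comm_group) hom_separates_from_finite_index_subgroup:
  assumes N: "subgroup N G" and fin: "finite (rcosets N)"
    and a: "a \<in> carrier G" "a \<notin> N"
    and "comm_group C"
    and divisible: "\<And>c m. c \<in> carrier C \<Longrightarrow> 0 < m \<Longrightarrow> \<exists>t\<in>carrier C. t [^]\<^bsub>C\<^esub> (m::nat) = c"
    and torsion: "\<And>m. 1 < m \<Longrightarrow> \<exists>t\<in>carrier C. t \<noteq> \<one>\<^bsub>C\<^esub> \<and> t [^]\<^bsub>C\<^esub> (m::nat) = \<one>\<^bsub>C\<^esub>"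
  shows "\<exists>\<xi>\<in>hom G C. (\<forall>n\<in>N. \<xi> n = \<one>\<^bsub>C\<^esub>) \<and> \<xi> a \<noteq> \<one>\<^bsub>C\<^esub>"
proof -
  interpret C: comm_group C by fact
  \<comment> \<open>The generating exponent is positive because it divides the index of
    \<open>N\<close>, a positive number. Roots of order \<open>m\<close> in \<open>C\<close> are
    therefore available.\<close>
  have pos_exponent: "\<exists>m>0. \<forall>k::int. x [^] k \<in> H \<longleftrightarrow> int m dvd k"
    if H: "subgroup H G" "N \<subseteq> H" and x: "x \<in> carrier G" for H x
  proof -
    have "H \<lhd> G" using H by (simp add: normal_iff_subgroup)
    then obtain m :: nat where m: "\<And>k::int. x [^] k \<in> H \<longleftrightarrow> int m dvd k"
      using normal.int_pow_mem_iff_dvd [OF _ x] by metis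
    have "x [^] int (card (rcosets N)) \<in> H"
      using pow_index_mem [OF N fin x] H by (auto simp: int_pow_int)
    then have "m dvd card (rcosets N)" by (simp add: m)
    moreover have "0 < card (rcosets N)"
      using fin rcosetsI [OF subgroup.subset [OF N] one_closed] by (auto simp: card_gt_0_iff)
    ultimately show ?thesis using m by (intro exI [of _ m]) (auto intro: Nat.gr0I)
  qed
  \<comment> \<open>The homomorphism is quantified away, so that \<open>good\<close> speaks of
    domains alone and finiteness of the set of overgroups applies.\<close>
  define good where "good H \<longleftrightarrow> subgroup H G \<and> N \<subseteq> H \<and> a \<in> H \<and>
    (\<exists>\<xi>\<in>hom (G\<lparr>carrier := H\<rparr>) C. (\<forall>n\<in>N. \<xi> n = \<one>\<^bsub>C\<^esub>) \<and> \<xi> a \<noteq> \<one>\<^bsub>C\<^esub>)" for H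
  have "finite (Collect good)"
    by (rule finite_subset [OF _ finite_overgroups_of_finite_index [OF N fin]])
      (auto simp: good_def)
  moreover have "Collect good \<noteq> {}"
  proof -
    obtain m where m: "m > 0" "\<And>k::int. a [^] k \<in> N \<longleftrightarrow> int m dvd k"
      using pos_exponent [OF N order_refl a(1)] by blast
    \<comment> \<open>Since \<open>a \<notin> N\<close>, the exponent exceeds \<open>1\<close>, so
      \<open>C\<close> has a nontrivial \<open>t\<close> whose \<open>m\<close>-th power is the
      identity. This is exactly the compatibility needed to extend the trivial map on
      \<open>N\<close> by the value \<open>t\<close> at \<open>a\<close>.\<close>
    have "m \<noteq> 1"
      using m(2) [of 1] a by auto
    then obtain t where t: "t \<in> carrier C" "t \<noteq> \<one>\<^bsub>C\<^esub>" "t [^]\<^bsub>C\<^esub> m = \<one>\<^bsub>C\<^esub>"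
      using torsion [of m] m(1) by (metis nat_neq_iff less_one)
    have "(\<lambda>_. \<one>\<^bsub>C\<^esub>) \<in> hom (G\<lparr>carrier := N\<rparr>) C"
      by (auto simp: hom_def)
    then obtain K \<eta> where "subgroup K G" "N \<subseteq> K" "a \<in> K" "\<eta> \<in> hom (G\<lparr>carrier := K\<rparr>) C"
      "\<And>h. h \<in> N \<Longrightarrow> \<eta> h = \<one>\<^bsub>C\<^esub>" "\<eta> a = t"
      using extend_hom_by_element [OF N \<open>comm_group C\<close> _ a(1) t(1) m(2)] t(3) by metis
    then have "good K"
      using t unfolding good_def by metis
    then show ?thesis by blast
  qed
  ultimately obtain H where "good H" and max: "\<And>K. good K \<Longrightarrow> H \<subseteq> K \<Longrightarrow> H = K"
    using finite_has_maximal [of "Collect good"] by auto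
  then obtain \<xi> where H: "subgroup H G" "N \<subseteq> H" "a \<in> H" and \<xi>: "\<xi> \<in> hom (G\<lparr>carrier := H\<rparr>) C"
    "\<And>n. n \<in> N \<Longrightarrow> \<xi> n = \<one>\<^bsub>C\<^esub>" "\<xi> a \<noteq> \<one>\<^bsub>C\<^esub>"
    by (auto simp: good_def)
  \<comment> \<open>An \<open>m\<close>-th root \<open>t\<close> of \<open>\<xi> (x [^] m)\<close>
    lets \<open>x\<close> be adjoined to \<open>H\<close>. The extension agrees with
    \<open>\<xi>\<close> on \<open>N\<close> and at \<open>a\<close>, so the larger domain is again
    \<open>good\<close>, and maximality puts \<open>x\<close> into \<open>H\<close>.\<close>
  have "x \<in> H" if x: "x \<in> carrier G" for x
  proof -
    obtain m where m: "m > 0" "\<And>k::int. x [^] k \<in> H \<longleftrightarrow> int m dvd k"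
      using pos_exponent [OF H(1,2) x] by blast
    have "x [^] m \<in> H"
      using m(2) [of "int m"] by (simp add: int_pow_int)
    then have "\<xi> (x [^] m) \<in> carrier C"
      using \<xi>(1) by (auto simp: hom_def)
    then obtain t where t: "t \<in> carrier C" "t [^]\<^bsub>C\<^esub> m = \<xi> (x [^] m)"
      using divisible m(1) by blast
    obtain K \<eta> where K: "subgroup K G" "H \<subseteq> K" "x \<in> K" "\<eta> \<in> hom (G\<lparr>carrier := K\<rparr>) C"
      "\<And>h. h \<in> H \<Longrightarrow> \<eta> h = \<xi> h"
      using extend_hom_by_element [OF H(1) \<open>comm_group C\<close> \<xi>(1) x t(1) m(2)] t(2) by metis
    have "N \<subseteq> K" "a \<in> K" "\<forall>n\<in>N. \<eta> n = \<one>\<^bsub>C\<^esub>" "\<eta> a \<noteq> \<one>\<^bsub>C\<^esub>"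
      using H K(2,5) \<xi>(2,3) by (auto simp: subset_iff)
    then have "good K"
      using K(1,4) unfolding good_def by blast
    then have "H = K"
      using max K(2) by simp
    then show ?thesis
      using K(3) by simp
  qed
  then have "H = carrier G"
    using subgroup.subset [OF H(1)] by blast
  then show ?thesis
    using \<xi> by auto
qed

section \<open>Orthogonality\<close>

text \<open>Translation by \<open>b\<close> permutes the group, hence fixes the sum, but it also
  multiplies the sum by \<open>f b \<noteq> 1\<close>.\<close>

lemma (in group) sum_nontrivial_character_eq_0:
  fixes f :: "'a \<Rightarrow> complex"
  assumes mult: "\<And>x y. x \<in> carrier G \<Longrightarrow> y \<in> carrier G \<Longrightarrow> f (x \<otimes> y) = f x * f y"
    and b: "b \<in> carrier G" "f b \<noteq> 1"
  shows "sum f (carrier G) = 0"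
proof -
  have "(\<lambda>x. b \<otimes> x) ` carrier G = carrier G" "inj_on (\<lambda>x. b \<otimes> x) (carrier G)"
    using b(1) by (auto simp: surj_const_mult intro: inj_onI)
  then have "sum f (carrier G) = (\<Sum>x\<in>carrier G. f (b \<otimes> x))"
    using sum.reindex [of "\<lambda>x. b \<otimes> x" "carrier G" f] by (simp add: o_def)
  also have "\<dots> = f b * sum f (carrier G)"
    using b(1) by (simp add: mult sum_distrib_left)
  finally show ?thesis
    using b(2) by simp
qed

text \<open>The sum of all values of \<open>P\<close> is computed in both orders. By orthogonality
  only the identity of \<open>F\<close> contributes in one order, giving the size of
  \<open>A\<close>, and only the identity of \<open>A\<close> in the other, giving the size of
  \<open>F\<close>.\<close>

lemma card_eq_of_nondegenerate_pairing:
  fixes P :: "'a \<Rightarrow> 'c \<Rightarrow> complex"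
  assumes "group A" "group F" "finite (carrier A)" "finite (carrier F)"
    and mult_A: "\<And>\<xi> a b. \<xi> \<in> carrier F \<Longrightarrow> a \<in> carrier A \<Longrightarrow> b \<in> carrier A \<Longrightarrow>
      P (a \<otimes>\<^bsub>A\<^esub> b) \<xi> = P a \<xi> * P b \<xi>"
    and mult_F: "\<And>a \<xi> \<psi>. a \<in> carrier A \<Longrightarrow> \<xi> \<in> carrier F \<Longrightarrow> \<psi> \<in> carrier F \<Longrightarrow>
      P a (\<xi> \<otimes>\<^bsub>F\<^esub> \<psi>) = P a \<xi> * P a \<psi>"
    and one_A: "\<And>\<xi>. \<xi> \<in> carrier F \<Longrightarrow> P \<one>\<^bsub>A\<^esub> \<xi> = 1"
    and one_F: "\<And>a. a \<in> carrier A \<Longrightarrow> P a \<one>\<^bsub>F\<^esub> = 1"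
    and nondeg_A: "\<And>a. a \<in> carrier A \<Longrightarrow> a \<noteq> \<one>\<^bsub>A\<^esub> \<Longrightarrow> \<exists>\<xi>\<in>carrier F. P a \<xi> \<noteq> 1"
    and nondeg_F: "\<And>\<xi>. \<xi> \<in> carrier F \<Longrightarrow> \<xi> \<noteq> \<one>\<^bsub>F\<^esub> \<Longrightarrow> \<exists>a\<in>carrier A. P a \<xi> \<noteq> 1"
  shows "card (carrier A) = card (carrier F)"
proof -
  interpret A: group A by fact
  interpret F: group F by fact
  have "(\<Sum>a\<in>carrier A. P a \<xi>) = (if \<xi> = \<one>\<^bsub>F\<^esub> then of_nat (card (carrier A)) else 0)"
    if "\<xi> \<in> carrier F" for \<xi>
    using A.sum_nontrivial_character_eq_0 [of "\<lambda>a. P a \<xi>"] nondeg_F [OF that] that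
    by (auto simp: mult_A one_F)
  then have "(\<Sum>\<xi>\<in>carrier F. \<Sum>a\<in>carrier A. P a \<xi>) = of_nat (card (carrier A))"
    using \<open>finite (carrier F)\<close> by simp
  moreover have "(\<Sum>\<xi>\<in>carrier F. P a \<xi>) = (if a = \<one>\<^bsub>A\<^esub> then of_nat (card (carrier F)) else 0)"
    if "a \<in> carrier A" for a
    using F.sum_nontrivial_character_eq_0 [of "P a"] nondeg_A [OF that] that
    by (auto simp: mult_F one_A)
  then have "(\<Sum>a\<in>carrier A. \<Sum>\<xi>\<in>carrier F. P a \<xi>) = of_nat (card (carrier F))"
    using \<open>finite (carrier A)\<close> by simp
  ultimately have "(of_nat (card (carrier A)) :: complex) = of_nat (card (carrier F))"
    by (metis sum.swap)
  then show ?thesis by simp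
qed

section \<open>The circle\<close>

abbreviation circle_proj :: "real \<Rightarrow> real set" where
  "circle_proj x \<equiv> \<int> #>\<^bsub>real_group\<^esub> x"

lemma one_circle_group: "\<one>\<^bsub>circle_group\<^esub> = circle_proj 0"
proof -
  interpret comm_group real_group by (rule comm_group_real_group)
  show ?thesis
    using coset_mult_one [of \<int>] by (simp add: circle_group_def)
qed

lemma circle_proj_eq_one_iff: "circle_proj x = \<one>\<^bsub>circle_group\<^esub> \<longleftrightarrow> x \<in> \<int>"
  by (simp add: one_circle_group circle_coset_eq_iff)

lemma circle_group_cases:
  assumes "c \<in> carrier circle_group"
  obtains x where "c = circle_proj x"
  using assms by (auto simp: carrier_circle_group)

lemma circle_proj_pow: "circle_proj x [^]\<^bsub>circle_group\<^esub> (n::nat) = circle_proj (real n * x)"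
proof -
  interpret comm_group circle_group by (rule comm_group_circle_group)
  show ?thesis
    by (induction n) (simp_all add: one_circle_group mult_circle_group algebra_simps)
qed

lemma circle_group_divisible:
  assumes "c \<in> carrier circle_group" "0 < (m::nat)"
  shows "\<exists>t\<in>carrier circle_group. t [^]\<^bsub>circle_group\<^esub> m = c"
proof -
  obtain x where "c = circle_proj x"
    using assms(1) by (rule circle_group_cases)
  then show ?thesis
    using assms(2) by (intro bexI [of _ "circle_proj (x / real m)"])
      (auto simp: circle_proj_pow carrier_circle_group)
qed

lemma circle_group_torsion:
  assumes "1 < (m::nat)"
  shows "\<exists>t\<in>carrier circle_group. t \<noteq> \<one>\<^bsub>circle_group\<^esub> \<and> t [^]\<^bsub>circle_group\<^esub> m = \<one>\<^bsub>circle_group\<^esub>"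
proof (intro bexI conjI)
  show "circle_proj (1 / real m) \<noteq> \<one>\<^bsub>circle_group\<^esub>"
    using assms Ints_nonzero_abs_less1 [of "1 / real m"] unfolding circle_proj_eq_one_iff
    by auto
  show "circle_proj (1 / real m) [^]\<^bsub>circle_group\<^esub> m = \<one>\<^bsub>circle_group\<^esub>"
    using assms by (simp add: circle_proj_pow circle_proj_eq_one_iff)
qed (simp add: carrier_circle_group)

lemma finite_circle_torsion:
  assumes "0 < (m::nat)"
  shows "finite {c \<in> carrier circle_group. c [^]\<^bsub>circle_group\<^esub> m = \<one>\<^bsub>circle_group\<^esub>}"
proof (rule finite_subset)
  show "{c \<in> carrier circle_group. c [^]\<^bsub>circle_group\<^esub> m = \<one>\<^bsub>circle_group\<^esub>}
    \<subseteq> (\<lambda>k. circle_proj (real k / real m)) ` {..<m}"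
  proof safe
    fix c assume "c \<in> carrier circle_group" and c: "c [^]\<^bsub>circle_group\<^esub> m = \<one>\<^bsub>circle_group\<^esub>"
    then obtain x where x: "c = circle_proj x"
      by (auto elim: circle_group_cases)
    then obtain j where j: "real m * x = of_int j"
      using c by (auto simp: circle_proj_pow circle_proj_eq_one_iff elim: Ints_cases)
    \<comment> \<open>With \<open>j = m * x\<close>, the residue \<open>k\<close> of
      \<open>j\<close> modulo \<open>m\<close> gives a fraction \<open>k / m\<close> differing from
      \<open>x\<close> by the integer \<open>j div m\<close>.\<close>
    define k where "k = nat (j mod int m)"
    have k: "int k = j mod int m"
      using assms by (simp add: k_def)
    have "j = int m * (j div int m) + int k"
      by (simp add: k)
    then have "real m * x = real m * of_int (j div int m) + real k"
      using j by (metis of_int_add of_int_mult of_int_of_nat_eq)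
    then have "x - real k / real m = of_int (j div int m)"
      using assms by (simp add: field_simps)
    then have "c = circle_proj (real k / real m)"
      by (simp add: x circle_coset_eq_iff)
    moreover have "k < m"
      using assms by (simp add: k_def nat_less_iff)
    ultimately show "c \<in> (\<lambda>k. circle_proj (real k / real m)) ` {..<m}"
      by blast
  qed
qed simp

text \<open>The open arc of radius \<open>1 / m\<close> around the identity contains no other
  \<open>m\<close>-torsion point: \<open>m * x\<close> would be an integer of absolute value below
  \<open>1\<close>. For characters of finite order, this turns the closed condition of having
  trivial value into an open one.\<close>

lemma circle_torsion_isolated_one:
  assumes "0 < (m::nat)"
  shows "\<exists>U. openin circle_topology U \<and> \<one>\<^bsub>circle_group\<^esub> \<in> U \<and>
    (\<forall>c\<in>U. c [^]\<^bsub>circle_group\<^esub> m = \<one>\<^bsub>circle_group\<^esub> \<longrightarrow> c = \<one>\<^bsub>circle_group\<^esub>)"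
proof (intro exI conjI ballI impI)
  let ?V = "{- 1 / real m <..< 1 / real m}"
  show "openin circle_topology (circle_proj ` ?V)"
    using open_map_circle by (auto simp: open_map_def)
  show "\<one>\<^bsub>circle_group\<^esub> \<in> circle_proj ` ?V"
    using assms unfolding one_circle_group by (intro imageI) auto
  fix c
  assume "c \<in> circle_proj ` ?V" and c: "c [^]\<^bsub>circle_group\<^esub> m = \<one>\<^bsub>circle_group\<^esub>"
  then obtain x where x: "c = circle_proj x" "- 1 / real m < x" "x < 1 / real m"
    by auto
  then have "\<bar>real m * x\<bar> < 1"
    using assms by (auto simp: field_simps abs_less_iff)
  moreover have "real m * x \<in> \<int>"
    using c by (simp add: x circle_proj_pow circle_proj_eq_one_iff)
  ultimately have "real m * x = 0"
    using Ints_nonzero_abs_less1 by blast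
  then have "x = 0"
    using assms by simp
  then show "c = \<one>\<^bsub>circle_group\<^esub>"
    by (simp add: x one_circle_group)
qed

text \<open>The standard embedding of the circle in the complex numbers, where character values can
  be added. Independence of the chosen representative is \<open>circle_cis_proj\<close>.\<close>

definition circle_cis :: "real set \<Rightarrow> complex" where
  "circle_cis c = cis (2 * pi * (SOME x. c = circle_proj x))"

lemma circle_cis_proj: "circle_cis (circle_proj x) = cis (2 * pi * x)"
proof -
  define y where "y = (SOME y. circle_proj x = circle_proj y)"
  have "circle_proj x = circle_proj y"
    unfolding y_def by (rule someI) (rule refl)
  then obtain k where "x - y = of_int k"
    by (auto simp: circle_coset_eq_iff elim: Ints_cases)
  then have "x = y + of_int k" by simp
  then have "cis (2 * pi * x) = cis (2 * pi * y)"
    by (simp add: distrib_left flip: cis_mult)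
  then show ?thesis
    by (simp add: circle_cis_def y_def)
qed

lemma circle_cis_mult:
  assumes "c \<in> carrier circle_group" "d \<in> carrier circle_group"
  shows "circle_cis (c \<otimes>\<^bsub>circle_group\<^esub> d) = circle_cis c * circle_cis d"
  using assms by (auto elim!: circle_group_cases
      simp: mult_circle_group circle_cis_proj cis_mult algebra_simps)

lemma circle_cis_eq_1_iff:
  assumes "c \<in> carrier circle_group"
  shows "circle_cis c = 1 \<longleftrightarrow> c = \<one>\<^bsub>circle_group\<^esub>"
proof -
  obtain x where x: "c = circle_proj x"
    using assms by (rule circle_group_cases)
  have "x \<in> \<int>" if "cis (2 * pi * x) = 1"
  proof -
    have "cos (2 * pi * x) = 1"
      using that by (metis cis.sel(1) one_complex.sel(1))
    then show ?thesis
      by (auto simp: cos_one_2pi_int)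
  qed
  then have "cis (2 * pi * x) = 1 \<longleftrightarrow> x \<in> \<int>"
    by auto
  then show ?thesis
    by (simp add: x circle_cis_proj circle_proj_eq_one_iff)
qed

section \<open>Annihilators in the precompact dual\<close>

definition annihilator :: "('a, 'b) monoid_scheme \<Rightarrow> ('a \<Rightarrow> real set) set \<Rightarrow> 'a set" where
  "annihilator G F = {x \<in> carrier G. \<forall>\<xi>\<in>F. \<xi> x = \<one>\<^bsub>circle_group\<^esub>}"

text \<open>The opposite direction to \<open>annihilator\<close>: the two maps form the
  order-reversing correspondence between subsets of \<open>G\<close> and sets of continuous
  characters.\<close>

definition character_annihilator ::
    "('a, 'b) monoid_scheme \<Rightarrow> 'a topology \<Rightarrow> 'a set \<Rightarrow> ('a \<Rightarrow> real set) set" where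
  "character_annihilator G \<tau> N =
     {\<xi> \<in> carrier (precompact_dual G \<tau>). \<forall>x\<in>N. \<xi> x = \<one>\<^bsub>circle_group\<^esub>}"

lemma annihilatorD: "x \<in> annihilator G F \<Longrightarrow> \<xi> \<in> F \<Longrightarrow> \<xi> x = \<one>\<^bsub>circle_group\<^esub>"
  by (simp add: annihilator_def)

lemma precompact_dual_simps:
  "carrier (precompact_dual G \<tau>) = continuous_characters G \<tau>"
  "\<xi> \<otimes>\<^bsub>precompact_dual G \<tau>\<^esub> \<eta> = (\<lambda>x\<in>carrier G. \<xi> x \<otimes>\<^bsub>circle_group\<^esub> \<eta> x)"
  "\<one>\<^bsub>precompact_dual G \<tau>\<^esub> = (\<lambda>x\<in>carrier G. \<one>\<^bsub>circle_group\<^esub>)"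
  by (simp_all add: precompact_dual_def)

section \<open>Pointwise operations on characters and continuity from open subgroups\<close>

context topological_abelian_group
begin

abbreviation dual where "dual \<equiv> precompact_dual G \<tau>"

sublocale circle: comm_group circle_group
  by (rule comm_group_circle_group)

sublocale dual: comm_group dual
  by (rule comm_group_precompact_dual)

lemma dual_character:
  assumes "\<xi> \<in> carrier dual"
  shows "group_hom G circle_group \<xi>" "continuous_map \<tau> circle_topology \<xi>"
    "\<xi> \<in> extensional (carrier G)"
  using assms group_axioms circle.group_axioms
  by (auto simp: precompact_dual_simps continuous_characters_def group_hom_def group_hom_axioms_def)

lemma dual_pow:
  assumes "x \<in> carrier G"
  shows "(\<xi> [^]\<^bsub>dual\<^esub> (n::nat)) x = \<xi> x [^]\<^bsub>circle_group\<^esub> n"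
  using assms by (induction n) (simp_all add: precompact_dual_simps)

text \<open>The inverse is taken in the group of continuous characters, so its values are not given
  by definition; they follow by evaluating the product of the inverse with \<open>\<xi>\<close> at
  \<open>x\<close>.\<close>

lemma dual_inv:
  assumes "\<xi> \<in> carrier dual" "x \<in> carrier G"
  shows "(inv\<^bsub>dual\<^esub> \<xi>) x = inv\<^bsub>circle_group\<^esub> (\<xi> x)"
proof -
  interpret \<xi>: group_hom G circle_group \<xi>
    by (rule dual_character) fact
  interpret \<xi>': group_hom G circle_group "inv\<^bsub>dual\<^esub> \<xi>"
    by (rule dual_character) (use assms in simp)
  have "(inv\<^bsub>dual\<^esub> \<xi> \<otimes>\<^bsub>dual\<^esub> \<xi>) x = \<one>\<^bsub>dual\<^esub> x"
    using assms by simp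
  then have "(inv\<^bsub>dual\<^esub> \<xi>) x \<otimes>\<^bsub>circle_group\<^esub> \<xi> x = \<one>\<^bsub>circle_group\<^esub>"
    using assms(2) by (simp add: precompact_dual_simps)
  then show ?thesis
    using assms(2) by (metis \<xi>'.hom_closed \<xi>.hom_closed circle.inv_equality)
qed

lemma openin_rcoset:
  assumes "openin \<tau> N" and x: "x \<in> carrier G"
  shows "openin \<tau> (N #> x)"
proof -
  have N: "N \<subseteq> carrier G"
    using openin_subset [OF assms(1)] by (simp add: topspace_eq_carrier)
  have "continuous_map \<tau> (prod_topology \<tau> \<tau>) (\<lambda>y. (y, inv x))"
    using x by (simp add: continuous_map_paired topspace_eq_carrier)
  from continuous_map_compose [OF this continuous_map_mult]
  have "continuous_map \<tau> \<tau> (\<lambda>y. y \<otimes> inv x)"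
    by (simp add: o_def)
  then have "openin \<tau> {y \<in> topspace \<tau>. y \<otimes> inv x \<in> N}"
    using assms(1) by (rule openin_continuous_map_preimage)
  \<comment> \<open>The coset is the preimage of \<open>N\<close> under the continuous translation
    by \<open>inv x\<close>.\<close>
  also have "{y \<in> topspace \<tau>. y \<otimes> inv x \<in> N} = N #> x"
  proof safe
    fix y assume "y \<in> topspace \<tau>" "y \<otimes> inv x \<in> N"
    moreover from this have "y = (y \<otimes> inv x) \<otimes> x"
      using x by (simp add: m_assoc topspace_eq_carrier)
    ultimately show "y \<in> N #> x"
      unfolding r_coset_def by blast
  next
    fix y assume "y \<in> N #> x"
    then obtain n where "n \<in> N" "y = n \<otimes> x"
      by (auto simp: r_coset_def)
    then show "y \<in> topspace \<tau>" "y \<otimes> inv x \<in> N"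
      using x N by (auto simp: m_assoc topspace_eq_carrier)
  qed
  finally show ?thesis .
qed

text \<open>Such a homomorphism is constant on each coset of \<open>N\<close>, and these cosets are
  open; it is thus locally constant, and preimages are unions of open cosets.\<close>

lemma continuous_hom_of_open_subgroup_in_kernel:
  assumes N: "subgroup N G" "openin \<tau> N"
    and \<xi>: "\<xi> \<in> hom G circle_group" "\<And>n. n \<in> N \<Longrightarrow> \<xi> n = \<one>\<^bsub>circle_group\<^esub>"
  shows "continuous_map \<tau> circle_topology \<xi>"
  unfolding continuous_map
proof (intro conjI allI impI)
  show "\<xi> ` topspace \<tau> \<subseteq> topspace circle_topology"
    using \<xi>(1) by (auto simp: topspace_eq_carrier topspace_circle_topology hom_def)
  fix U
  show "openin \<tau> {x \<in> topspace \<tau>. \<xi> x \<in> U}"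
  proof (subst openin_subopen, safe)
    fix x assume x: "x \<in> topspace \<tau>" "\<xi> x \<in> U"
    then have xG: "x \<in> carrier G"
      by (simp add: topspace_eq_carrier)
    have "N #> x \<subseteq> {x \<in> topspace \<tau>. \<xi> x \<in> U}"
    proof
      fix y assume "y \<in> N #> x"
      then obtain n where n: "n \<in> N" "y = n \<otimes> x"
        by (auto simp: r_coset_def)
      then have nG: "n \<in> carrier G"
        using N(1) by (simp add: subgroup.mem_carrier)
      then have "\<xi> y = \<xi> x"
        using \<xi> n xG by (auto simp: hom_def Pi_iff)
      then show "y \<in> {x \<in> topspace \<tau>. \<xi> x \<in> U}"
        using n nG xG x by (simp add: topspace_eq_carrier)
    qed
    then show "\<exists>T. openin \<tau> T \<and> x \<in> T \<and> T \<subseteq> {x \<in> topspace \<tau>. \<xi> x \<in> U}"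
      using openin_rcoset [OF N(2) xG] rcos_self [OF xG N(1)] by blast
  qed
qed

section \<open>Annihilators of finite groups of characters\<close>

lemma subgroup_annihilator:
  assumes "F \<subseteq> carrier dual"
  shows "subgroup (annihilator G F) G"
proof -
  have hom: "group_hom G circle_group \<xi>" if "\<xi> \<in> F" for \<xi>
    using that assms dual_character by blast
  show ?thesis
  proof (rule subgroupI)
    show "annihilator G F \<subseteq> carrier G"
      by (auto simp: annihilator_def)
    show "annihilator G F \<noteq> {}"
      using group_hom.hom_one [OF hom] by (auto simp: annihilator_def)
  next
    fix x y assume x: "x \<in> annihilator G F" and y: "y \<in> annihilator G F"
    have "\<xi> (x \<otimes> y) = \<one>\<^bsub>circle_group\<^esub>" if "\<xi> \<in> F" for \<xi>
      using group_hom.hom_mult [OF hom [OF that], of x y] annihilatorD [OF x that]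
        annihilatorD [OF y that] x y by (simp add: annihilator_def)
    then show "x \<otimes> y \<in> annihilator G F"
      using x y by (simp add: annihilator_def)
  next
    fix x assume x: "x \<in> annihilator G F"
    have "\<xi> (inv x) = \<one>\<^bsub>circle_group\<^esub>" if "\<xi> \<in> F" for \<xi>
      using group_hom.hom_inv [OF hom [OF that], of x] annihilatorD [OF x that] x
      by (simp add: annihilator_def)
    then show "inv x \<in> annihilator G F"
      using x by (simp add: annihilator_def)
  qed
qed

text \<open>By Lagrange in \<open>F\<close>, every value of a character in \<open>F\<close> is
  killed by \<open>card F\<close>. Near the identity the only such circle element is the identity
  itself, so the annihilator is a finite intersection of preimages of an open set
  \<open>U\<close>.\<close>

lemma openin_annihilator:
  assumes F: "subgroup F dual" "finite F"
  shows "openin \<tau> (annihilator G F)"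
proof -
  interpret F: group "dual\<lparr>carrier := F\<rparr>"
    by (rule dual.subgroup_imp_group [OF F(1)])
  have ne: "F \<noteq> {}"
    using subgroup.one_closed [OF F(1)] by blast
  have "0 < card F"
    using F(2) ne by (simp add: card_gt_0_iff)
  then obtain U where U: "openin circle_topology U" "\<one>\<^bsub>circle_group\<^esub> \<in> U"
    "\<And>c. c \<in> U \<Longrightarrow> c [^]\<^bsub>circle_group\<^esub> card F = \<one>\<^bsub>circle_group\<^esub> \<Longrightarrow> c = \<one>\<^bsub>circle_group\<^esub>"
    using circle_torsion_isolated_one by metis
  have pow: "\<xi> x [^]\<^bsub>circle_group\<^esub> card F = \<one>\<^bsub>circle_group\<^esub>" if "\<xi> \<in> F" "x \<in> carrier G" for \<xi> x
  proof -
    have "\<xi> [^]\<^bsub>dual\<^esub> card F = \<one>\<^bsub>dual\<^esub>"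
      using F.pow_order_eq_1 [of \<xi>] that(1) dual.nat_pow_consistent [of \<xi> "card F" F]
      by (simp add: order_def)
    then show ?thesis
      using that(2) by (simp add: precompact_dual_simps flip: dual_pow)
  qed
  have "annihilator G F = (\<Inter>\<xi>\<in>F. {x \<in> topspace \<tau>. \<xi> x \<in> U})"
  proof (intro Set.set_eqI iffI)
    fix x assume x: "x \<in> annihilator G F"
    then have "x \<in> topspace \<tau>"
      by (simp add: annihilator_def topspace_eq_carrier)
    moreover have "\<xi> x \<in> U" if "\<xi> \<in> F" for \<xi>
      using U(2) annihilatorD [OF x that] by simp
    ultimately show "x \<in> (\<Inter>\<xi>\<in>F. {x \<in> topspace \<tau>. \<xi> x \<in> U})"
      by simp
  next
    fix x assume x: "x \<in> (\<Inter>\<xi>\<in>F. {x \<in> topspace \<tau>. \<xi> x \<in> U})"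
    then have xG: "x \<in> carrier G"
      using ne by (auto simp: topspace_eq_carrier)
    have "\<xi> x = \<one>\<^bsub>circle_group\<^esub>" if "\<xi> \<in> F" for \<xi>
      using x that U(3) [OF _ pow [OF that xG]] by simp
    then show "x \<in> annihilator G F"
      using xG by (simp add: annihilator_def)
  qed
  moreover have "openin \<tau> {x \<in> topspace \<tau>. \<xi> x \<in> U}" if "\<xi> \<in> F" for \<xi>
    using subgroup.mem_carrier [OF F(1) that] U(1)
    by (intro openin_continuous_map_preimage [OF dual_character(2)])
  ultimately show ?thesis
    using F(2) ne by (auto intro!: openin_Inter)
qed

text \<open>Evaluation pairs \<open>G Mod annihilator G F\<close> with \<open>F\<close>. It is
  nondegenerate in the first argument by the definition of the annihilator, and in the second
  because a character trivial on all of \<open>G\<close> is the identity of the dual.\<close>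

lemma card_rcosets_annihilator:
  assumes F: "subgroup F dual" "finite F" and fin: "finite (rcosets (annihilator G F))"
  shows "card (rcosets (annihilator G F)) = card F"
proof -
  let ?N = "annihilator G F"
  interpret F: group "dual\<lparr>carrier := F\<rparr>"
    by (rule dual.subgroup_imp_group [OF F(1)])
  have sub: "F \<subseteq> carrier dual"
    using F(1) by (rule subgroup.subset)
  have "?N \<lhd> G"
    by (simp add: normal_iff_subgroup subgroup_annihilator [OF sub])
  then interpret N: normal ?N G .
  have hom: "group_hom G circle_group \<xi>" if "\<xi> \<in> F" for \<xi>
    using that sub dual_character by blast
  \<comment> \<open>Each \<open>\<xi> \<in> F\<close> is constant on cosets of its annihilator, so
    its image of a coset is a singleton and \<open>the_elem\<close> reads off the value.\<close>
  define P where "P C \<xi> = circle_cis (the_elem (\<xi> ` C))" for C :: "'a set" and \<xi>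
  have P: "P (?N #> x) \<xi> = circle_cis (\<xi> x)" if "\<xi> \<in> F" "x \<in> carrier G" for \<xi> x
  proof -
    interpret \<xi>: group_hom G circle_group \<xi>
      by (rule hom) fact
    have "\<xi> y = \<xi> x" if y: "y \<in> ?N #> x" for y
    proof -
      obtain n where n: "n \<in> ?N" "y = n \<otimes> x"
        using y by (auto simp: r_coset_def)
      then have "\<xi> n = \<one>\<^bsub>circle_group\<^esub>" "n \<in> carrier G"
        using annihilatorD [OF n(1) \<open>\<xi> \<in> F\<close>] by simp_all
      then show ?thesis
        using n(2) \<open>x \<in> carrier G\<close> by simp
    qed
    moreover have "x \<in> ?N #> x"
      using that(2) N.subgroup_axioms by (rule rcos_self)
    ultimately have "\<xi> ` (?N #> x) = {\<xi> x}"
      by blast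
    then show ?thesis
      by (simp add: P_def)
  qed
  have closed: "\<xi> x \<in> carrier circle_group" if "\<xi> \<in> F" "x \<in> carrier G" for \<xi> x
    using group_hom.hom_closed [OF hom] that by blast
  have cases: "\<exists>x\<in>carrier G. C = ?N #> x" if "C \<in> carrier (G Mod ?N)" for C
    using that by (auto simp: carrier_FactGroup)
  have cosetI: "?N #> x \<in> carrier (G Mod ?N)" if "x \<in> carrier G" for x
    using that by (auto simp: carrier_FactGroup)
  \<comment> \<open>The identity of the quotient is \<open>?N\<close> itself; written as the coset
    of \<open>\<one>\<close> it falls under the formula \<open>P\<close>.\<close>
  have N_eq: "?N = ?N #> \<one>"
    by (simp add: N.subset)
  have "card (carrier (G Mod ?N)) = card (carrier (dual\<lparr>carrier := F\<rparr>))"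
  proof (rule card_eq_of_nondegenerate_pairing [where P = P])
    show "group (G Mod ?N)"
      by (rule N.factorgroup_is_group)
    show "finite (carrier (G Mod ?N))"
      using fin by (simp add: FactGroup_def)
    show "finite (carrier (dual\<lparr>carrier := F\<rparr>))"
      using F(2) by simp
  next
    fix \<xi> C D
    assume \<xi>: "\<xi> \<in> carrier (dual\<lparr>carrier := F\<rparr>)" and "C \<in> carrier (G Mod ?N)" "D \<in> carrier (G Mod ?N)"
    then obtain x y where xy: "x \<in> carrier G" "y \<in> carrier G" "C = ?N #> x" "D = ?N #> y"
      using cases by meson
    then have "C \<otimes>\<^bsub>G Mod ?N\<^esub> D = ?N #> (x \<otimes> y)"
      by (simp add: N.rcos_sum)
    then show "P (C \<otimes>\<^bsub>G Mod ?N\<^esub> D) \<xi> = P C \<xi> * P D \<xi>"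
      using \<xi> xy by (simp add: P group_hom.hom_mult [OF hom, of \<xi>] circle_cis_mult closed)
  next
    fix C \<xi> \<eta>
    assume "C \<in> carrier (G Mod ?N)"
      and \<xi>: "\<xi> \<in> carrier (dual\<lparr>carrier := F\<rparr>)" "\<eta> \<in> carrier (dual\<lparr>carrier := F\<rparr>)"
    then obtain x where x: "x \<in> carrier G" "C = ?N #> x"
      using cases by blast
    have "\<xi> \<otimes>\<^bsub>dual\<^esub> \<eta> \<in> F"
      using \<xi> subgroup.m_closed [OF F(1)] by simp
    then show "P C (\<xi> \<otimes>\<^bsub>dual\<lparr>carrier := F\<rparr>\<^esub> \<eta>) = P C \<xi> * P C \<eta>"
      using \<xi> x P [of "\<xi> \<otimes>\<^bsub>dual\<^esub> \<eta>" x]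
      by (simp add: P precompact_dual_simps circle_cis_mult closed)
  next
    fix \<xi> assume "\<xi> \<in> carrier (dual\<lparr>carrier := F\<rparr>)"
    then show "P \<one>\<^bsub>G Mod ?N\<^esub> \<xi> = 1"
      using P [of \<xi> \<one>] group_hom.hom_one [OF hom, of \<xi>] N_eq
      by (simp add: circle_cis_eq_1_iff)
  next
    fix C assume "C \<in> carrier (G Mod ?N)"
    then obtain x where x: "x \<in> carrier G" "C = ?N #> x"
      using cases by blast
    then show "P C \<one>\<^bsub>dual\<lparr>carrier := F\<rparr>\<^esub> = 1"
      using P [OF subgroup.one_closed [OF F(1)] x(1)]
      by (simp add: precompact_dual_simps circle_cis_eq_1_iff)
    assume "C \<noteq> \<one>\<^bsub>G Mod ?N\<^esub>"
    then have "x \<notin> ?N"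
      using x N.subgroup_axioms by (auto simp: coset_join2)
    then obtain \<xi> where "\<xi> \<in> F" "\<xi> x \<noteq> \<one>\<^bsub>circle_group\<^esub>"
      using x(1) unfolding annihilator_def by blast
    then show "\<exists>\<xi>\<in>carrier (dual\<lparr>carrier := F\<rparr>). P C \<xi> \<noteq> 1"
      using x by (intro bexI [of _ \<xi>]) (simp_all add: P circle_cis_eq_1_iff closed)
  next
    fix \<xi> assume \<xi>: "\<xi> \<in> carrier (dual\<lparr>carrier := F\<rparr>)" "\<xi> \<noteq> \<one>\<^bsub>dual\<lparr>carrier := F\<rparr>\<^esub>"
    have "\<exists>x\<in>carrier G. \<xi> x \<noteq> \<one>\<^bsub>circle_group\<^esub>"
    proof (rule ccontr)
      assume "\<not> ?thesis"
      then have "\<xi> = \<one>\<^bsub>dual\<^esub>"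
        using \<xi>(1) sub dual_character(3) [of \<xi>]
        by (intro extensionalityI [of _ "carrier G"]) (auto simp: precompact_dual_simps)
      then show False
        using \<xi>(2) by simp
    qed
    then obtain x where "x \<in> carrier G" "\<xi> x \<noteq> \<one>\<^bsub>circle_group\<^esub>"
      by blast
    then show "\<exists>C\<in>carrier (G Mod ?N). P C \<xi> \<noteq> 1"
      using \<xi>(1) cosetI by (intro bexI [of _ "?N #> x"]) (simp_all add: P circle_cis_eq_1_iff closed)
  qed (rule F.group_axioms)
  then show ?thesis
    by (simp add: FactGroup_def)
qed

section \<open>Characters trivial on an open subgroup of finite index\<close>

lemma subgroup_character_annihilator:
  assumes "N \<subseteq> carrier G"
  shows "subgroup (character_annihilator G \<tau> N) dual"
proof (rule dual.subgroupI)
  show "character_annihilator G \<tau> N \<subseteq> carrier dual"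
    by (auto simp: character_annihilator_def)
  have "\<one>\<^bsub>dual\<^esub> x = \<one>\<^bsub>circle_group\<^esub>" if "x \<in> N" for x
    using that assms by (auto simp: precompact_dual_simps)
  then show "character_annihilator G \<tau> N \<noteq> {}"
    unfolding character_annihilator_def using dual.one_closed by blast
  fix \<xi> assume \<xi>: "\<xi> \<in> character_annihilator G \<tau> N"
  then show "inv\<^bsub>dual\<^esub> \<xi> \<in> character_annihilator G \<tau> N"
    using assms by (auto simp: character_annihilator_def dual_inv subset_iff)
  fix \<eta> assume \<eta>: "\<eta> \<in> character_annihilator G \<tau> N"
  have "(\<xi> \<otimes>\<^bsub>dual\<^esub> \<eta>) x = \<one>\<^bsub>circle_group\<^esub>" if "x \<in> N" for x
    using that assms \<xi> \<eta> by (auto simp: character_annihilator_def precompact_dual_simps(2))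
  then show "\<xi> \<otimes>\<^bsub>dual\<^esub> \<eta> \<in> character_annihilator G \<tau> N"
    using \<xi> \<eta> by (simp add: character_annihilator_def)
qed

text \<open>A character trivial on \<open>N\<close> is determined by the function it induces on the
  finitely many cosets, and its values are torsion of exponent the index of \<open>N\<close>, of
  which the circle has finitely many.\<close>

lemma finite_character_annihilator:
  assumes N: "subgroup N G" and fin: "finite (rcosets N)"
  shows "finite (character_annihilator G \<tau> N)"
proof (rule finite_subset)
  let ?m = "card (rcosets N)"
  let ?T = "{c \<in> carrier circle_group. c [^]\<^bsub>circle_group\<^esub> ?m = \<one>\<^bsub>circle_group\<^esub>}"
  show "character_annihilator G \<tau> N
      \<subseteq> (\<lambda>f. \<lambda>x\<in>carrier G. f (N #> x)) ` (\<Pi>\<^sub>E C\<in>rcosets N. ?T)"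
  proof
    fix \<xi> assume \<xi>: "\<xi> \<in> character_annihilator G \<tau> N"
    then have "\<xi> \<in> carrier dual" and one: "\<And>n. n \<in> N \<Longrightarrow> \<xi> n = \<one>\<^bsub>circle_group\<^esub>"
      by (auto simp: character_annihilator_def)
    then interpret \<xi>: group_hom G circle_group \<xi>
      by (intro dual_character)
    define f where "f = (\<lambda>C\<in>rcosets N. the_elem (\<xi> ` C))"
    have image: "\<xi> ` (N #> x) = {\<xi> x}" if "x \<in> carrier G" for x
    proof -
      have "\<xi> y = \<xi> x" if "y \<in> N #> x" for y
        using that \<open>x \<in> carrier G\<close> subgroup.subset [OF N] by (auto simp: r_coset_def one subset_iff)
      moreover have "x \<in> N #> x"
        using that N by (rule rcos_self)
      ultimately show ?thesis by blast
    qed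
    have f: "f (N #> x) = \<xi> x" if "x \<in> carrier G" for x
      using that image subgroup.subset [OF N] by (simp add: f_def rcosetsI)
    have "f \<in> (\<Pi>\<^sub>E C\<in>rcosets N. ?T)"
    proof (rule PiE_I)
      fix C assume "C \<in> rcosets N"
      then obtain x where x: "x \<in> carrier G" "C = N #> x"
        by (auto simp: RCOSETS_def)
      have "\<xi> x [^]\<^bsub>circle_group\<^esub> ?m = \<xi> (x [^] ?m)"
        using x by (simp add: \<xi>.hom_nat_pow)
      also have "\<dots> = \<one>\<^bsub>circle_group\<^esub>"
        using one pow_index_mem [OF N fin] x by simp
      finally show "f C \<in> ?T"
        using x by (simp add: f)
    qed (simp add: f_def)
    moreover have "\<xi> = (\<lambda>x\<in>carrier G. f (N #> x))"
      using dual_character(3) [OF \<open>\<xi> \<in> carrier dual\<close>]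
      by (intro extensionalityI [of _ "carrier G"]) (auto simp: f)
    ultimately show "\<xi> \<in> (\<lambda>f. \<lambda>x\<in>carrier G. f (N #> x)) ` (\<Pi>\<^sub>E C\<in>rcosets N. ?T)"
      by (intro image_eqI)
  qed
  have "rcosets N \<noteq> {}"
    using subgroup.subset [OF N] rcosetsI by blast
  then have "0 < ?m"
    using fin by (simp add: card_gt_0_iff)
  then show "finite ((\<lambda>f. \<lambda>x\<in>carrier G. f (N #> x)) ` (\<Pi>\<^sub>E C\<in>rcosets N. ?T))"
    using fin by (intro finite_imageI finite_PiE finite_circle_torsion)
qed

text \<open>A point outside \<open>N\<close> is separated from \<open>N\<close> by a homomorphism to
  the circle trivial on \<open>N\<close>. Openness of \<open>N\<close> makes this homomorphism
  continuous, so it belongs to the dual.\<close>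

lemma annihilator_character_annihilator:
  assumes N: "subgroup N G" "finite (rcosets N)" "openin \<tau> N"
  shows "annihilator G (character_annihilator G \<tau> N) = N"
proof
  show "N \<subseteq> annihilator G (character_annihilator G \<tau> N)"
    using subgroup.subset [OF N(1)] by (auto simp: annihilator_def character_annihilator_def)
  show "annihilator G (character_annihilator G \<tau> N) \<subseteq> N"
  proof (rule ccontr)
    assume "\<not> ?thesis"
    then obtain a where a: "a \<in> annihilator G (character_annihilator G \<tau> N)" "a \<notin> N"
      by blast
    then have aG: "a \<in> carrier G"
      by (simp add: annihilator_def)
    obtain \<xi> where \<xi>: "\<xi> \<in> hom G circle_group" "\<And>n. n \<in> N \<Longrightarrow> \<xi> n = \<one>\<^bsub>circle_group\<^esub>"
      "\<xi> a \<noteq> \<one>\<^bsub>circle_group\<^esub>"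
      using hom_separates_from_finite_index_subgroup [OF N(1,2) aG a(2) comm_group_circle_group
          circle_group_divisible circle_group_torsion] by metis
    \<comment> \<open>Elements of the dual are extensional, so the separating homomorphism has to be
      cut down to the carrier.\<close>
    define \<eta> where "\<eta> = restrict \<xi> (carrier G)"
    have "\<xi> x = \<eta> x" if "x \<in> topspace \<tau>" for x
      using that by (simp add: \<eta>_def topspace_eq_carrier)
    then have "continuous_map \<tau> circle_topology \<eta>"
      using continuous_hom_of_open_subgroup_in_kernel [OF N(1,3) \<xi>(1,2)] continuous_map_eq
      by blast
    moreover have "\<eta> \<in> hom G circle_group"
      using \<xi>(1) by (auto simp: hom_def \<eta>_def)
    ultimately have "\<eta> \<in> carrier dual"
      by (simp add: precompact_dual_simps continuous_characters_def \<eta>_def)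
    then have "\<eta> \<in> character_annihilator G \<tau> N"
      using \<xi>(2) subgroup.subset [OF N(1)] by (auto simp: character_annihilator_def \<eta>_def)
    then show False
      using a(1) \<xi>(3) aG by (auto simp: annihilator_def \<eta>_def)
  qed
qed

section \<open>Trajectories in the dual and cotrajectories in the group\<close>

lemma funpow_dual_endomorphism:
  assumes \<phi>: "\<phi> \<in> carrier G \<rightarrow> carrier G" and "x \<in> carrier G"
  shows "(dual_endomorphism G \<phi> ^^ n) \<xi> x = \<xi> ((\<phi> ^^ n) x)"
  using assms(2)
proof (induction n arbitrary: x)
  case (Suc n)
  then have "\<phi> x \<in> carrier G"
    using \<phi> by blast
  with Suc show ?case
    by (simp add: dual_endomorphism_def compose_def funpow_swap1)
qed simp

lemma funpow_dual_endomorphism_hom: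
  assumes "\<phi> \<in> hom G G" "continuous_map \<tau> \<tau> \<phi>"
  shows "dual_endomorphism G \<phi> ^^ n \<in> hom dual dual"
proof (induction n)
  case (Suc n)
  then show ?case
    using dual_endomorphism_hom [OF assms] by (auto simp: hom_def Pi_iff)
qed (simp add: hom_def)

lemma subgroup_funpow_dual_image:
  assumes "\<phi> \<in> hom G G" "continuous_map \<tau> \<tau> \<phi>" "subgroup F dual"
  shows "subgroup ((dual_endomorphism G \<phi> ^^ n) ` F) dual"
proof -
  interpret group_hom dual dual "dual_endomorphism G \<phi> ^^ n"
    by unfold_locales (rule funpow_dual_endomorphism_hom [OF assms(1,2)])
  show ?thesis
    by (rule subgroup_img_is_subgroup [OF assms(3)])
qed

lemma subgroup_trajectory_dual:
  assumes "\<phi> \<in> hom G G" "continuous_map \<tau> \<tau> \<phi>" "subgroup F dual"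
  shows "subgroup (trajectory dual (dual_endomorphism G \<phi>) F n) dual"
proof (induction n)
  case 0
  then show ?case by (simp add: dual.triv_subgroup)
next
  case (Suc n)
  then show ?case
    by (simp add: dual.mult_subgroups subgroup_funpow_dual_image [OF assms])
qed

lemma annihilator_set_mult:
  assumes F: "subgroup F dual" and K: "subgroup K dual"
  shows "annihilator G (F <#>\<^bsub>dual\<^esub> K) = annihilator G F \<inter> annihilator G K"
proof safe
  fix x assume x: "x \<in> annihilator G (F <#>\<^bsub>dual\<^esub> K)"
  \<comment> \<open>Multiplying by the identity of the other factor places each factor inside the
    product.\<close>
  have "F \<subseteq> F <#>\<^bsub>dual\<^esub> K" "K \<subseteq> F <#>\<^bsub>dual\<^esub> K"
    using subgroup.one_closed [OF F] subgroup.one_closed [OF K]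
      subgroup.mem_carrier [OF F] subgroup.mem_carrier [OF K]
    unfolding set_mult_def by (force intro: dual.r_one [symmetric] dual.l_one [symmetric])+
  then show "x \<in> annihilator G F" "x \<in> annihilator G K"
    using x by (auto simp: annihilator_def)
next
  fix x assume x: "x \<in> annihilator G F" "x \<in> annihilator G K"
  have "(\<xi> \<otimes>\<^bsub>dual\<^esub> \<eta>) x = \<one>\<^bsub>circle_group\<^esub>" if "\<xi> \<in> F" "\<eta> \<in> K" for \<xi> \<eta>
  proof -
    have "\<xi> x = \<one>\<^bsub>circle_group\<^esub>" "\<eta> x = \<one>\<^bsub>circle_group\<^esub>" "x \<in> carrier G"
      using annihilatorD [OF x(1) that(1)] annihilatorD [OF x(2) that(2)] x(1)
      by (simp_all add: annihilator_def)
    then show ?thesis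
      by (simp add: precompact_dual_simps(2))
  qed
  then show "x \<in> annihilator G (F <#>\<^bsub>dual\<^esub> K)"
    using x(1) by (auto simp: annihilator_def set_mult_def)
qed

text \<open>Products of character groups turn into intersections of annihilators, and the image
  under the \<open>n\<close>-th iterate of the dual map turns into the preimage under
  \<open>\<phi> ^^ n\<close>, because the iterate of the dual map is composition with
  \<open>\<phi> ^^ n\<close>.\<close>

lemma annihilator_trajectory:
  assumes \<phi>: "\<phi> \<in> hom G G" "continuous_map \<tau> \<tau> \<phi>" and F: "subgroup F dual"
  shows "annihilator G (trajectory dual (dual_endomorphism G \<phi>) F n) =
    cotrajectory G \<phi> (annihilator G F) n"
proof (induction n)
  \<comment> \<open>Both sides are the whole group: the trivial character annihilates everything,
    and the intersection over \<open>i < 0\<close> is unrestricted.\<close>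
  case 0
  then show ?case
    by (auto simp: annihilator_def cotrajectory_def precompact_dual_simps(3))
next
  case (Suc n)
  have \<phi>_fun: "\<phi> \<in> carrier G \<rightarrow> carrier G"
    using \<phi>(1) by (simp add: hom_def)
  have "(\<phi> ^^ n) x \<in> carrier G" if "x \<in> carrier G" for x
    using that \<phi>_fun by (induction n) auto
  then have "annihilator G ((dual_endomorphism G \<phi> ^^ n) ` F) =
      carrier G \<inter> (\<phi> ^^ n) -` annihilator G F"
    by (auto simp: annihilator_def funpow_dual_endomorphism [OF \<phi>_fun])
  then show ?case
    using Suc annihilator_set_mult [OF subgroup_trajectory_dual [OF \<phi> F]
        subgroup_funpow_dual_image [OF \<phi> F]]
    by (auto simp: cotrajectory_def less_Suc_eq)
qed

end

section \<open>Total boundedness and the comparison of entropies\<close>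

context precompact_abelian_group
begin

text \<open>An open subgroup is itself a neighborhood of the identity, so total boundedness covers
  \<open>G\<close> by finitely many of its cosets.\<close>

lemma finite_index_of_open_subgroup:
  assumes N: "subgroup N G" "openin \<tau> N"
  shows "finite (rcosets N)"
proof -
  obtain K where K: "finite K" "K \<subseteq> carrier G" "N <#> K = carrier G"
    using totally_bounded N(2) subgroup.one_closed [OF N(1)]
    unfolding totally_bounded_group_def by meson
  have "rcosets N \<subseteq> (\<lambda>k. N #> k) ` K"
  proof
    fix C assume "C \<in> rcosets N"
    then obtain x where x: "x \<in> carrier G" "C = N #> x"
      by (auto simp: RCOSETS_def)
    then obtain n k where k: "n \<in> N" "k \<in> K" "x = n \<otimes> k"
      using K(3) unfolding set_mult_def by blast
    then have "x \<in> N #> k"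
      unfolding r_coset_def by blast
    then have "N #> k = N #> x"
      using K(2) k(2) N(1) by (intro repr_independence) (simp_all add: subsetD)
    then show "C \<in> (\<lambda>k. N #> k) ` K"
      using x k by blast
  qed
  then show ?thesis
    using K(1) finite_surj by blast
qed

text \<open>This matches the index sets of the two suprema. A given \<open>N\<close> is the
  annihilator of the finite group of characters trivial on it; conversely annihilators of finite
  groups are open, hence of finite index.\<close>

lemma open_finite_index_subgroups_eq_annihilators:
  "open_finite_index_subgroups G \<tau> = annihilator G ` {F. subgroup F dual \<and> finite F}"
proof safe
  fix N assume "N \<in> open_finite_index_subgroups G \<tau>"
  then have N: "subgroup N G" "finite (rcosets N)" "openin \<tau> N"
    by (auto simp: open_finite_index_subgroups_def finite_index_subgroups_def)
  show "N \<in> annihilator G ` {F. subgroup F dual \<and> finite F}"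
    using annihilator_character_annihilator [OF N] finite_character_annihilator [OF N(1,2)]
      subgroup_character_annihilator [OF subgroup.subset [OF N(1)]]
    by blast
next
  fix F assume F: "subgroup F dual" "finite F"
  then show "annihilator G F \<in> open_finite_index_subgroups G \<tau>"
    using subgroup_annihilator [OF subgroup.subset [OF F(1)]] openin_annihilator [OF F]
    by (simp add: open_finite_index_subgroups_def finite_index_subgroups_def
        finite_index_of_open_subgroup)
qed

text \<open>Each trajectory of \<open>F\<close> is again a finite subgroup of the dual, and its
  annihilator is the cotrajectory. Counting cosets then shows that the two sequences agree term by
  term, so their limits coincide.\<close>

lemma adjoint_entropy_wrt_annihilator:
  assumes \<phi>: "\<phi> \<in> hom G G" "continuous_map \<tau> \<tau> \<phi>" and F: "subgroup F dual" "finite F"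
  shows "adjoint_entropy_wrt G \<phi> (annihilator G F) =
    algebraic_entropy_wrt dual (dual_endomorphism G \<phi>) F"
proof -
  have "order (G Mod cotrajectory G \<phi> (annihilator G F) n) =
      card (trajectory dual (dual_endomorphism G \<phi>) F n)" for n
  proof -
    let ?T = "trajectory dual (dual_endomorphism G \<phi>) F n"
    have T: "subgroup ?T dual" "finite ?T"
    proof -
      show "subgroup ?T dual"
        by (rule subgroup_trajectory_dual [OF \<phi> F(1)])
      show "finite ?T"
        using F(2) by (induction n) (auto simp: set_mult_def)
    qed
    have "finite (rcosets (annihilator G ?T))"
      using T subgroup.subset
      by (intro finite_index_of_open_subgroup subgroup_annihilator openin_annihilator) auto
    then show ?thesis
      using card_rcosets_annihilator [OF T]
      by (simp add: annihilator_trajectory [OF \<phi> F(1)] order_def FactGroup_def)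
  qed
  then show ?thesis
    by (simp add: adjoint_entropy_wrt_def algebraic_entropy_wrt_def)
qed

end

theorem theorem1p5:
  fixes G :: "('a, 'b) monoid_scheme" and \<tau> :: "'a topology" and \<phi> :: "'a \<Rightarrow> 'a"
  assumes "precompact_abelian_group G \<tau>"
    and "\<phi> \<in> hom G G"
    and "continuous_map \<tau> \<tau> \<phi>"
  shows "topological_adjoint_entropy G \<tau> \<phi> =
         algebraic_entropy (precompact_dual G \<tau>) (dual_endomorphism G \<phi>)"
proof -
  interpret precompact_abelian_group G \<tau> by fact
  let ?\<F> = "{F. subgroup F dual \<and> finite F}"
  \<comment> \<open>The supremum over open subgroups is reindexed along the surjection
    \<open>annihilator G\<close>; several \<open>F\<close> with one annihilator would do no
    harm.\<close>
  have "(\<lambda>F. ereal (adjoint_entropy_wrt G \<phi> (annihilator G F))) ` ?\<F> =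
      (\<lambda>F. ereal (algebraic_entropy_wrt dual (dual_endomorphism G \<phi>) F)) ` ?\<F>"
    using adjoint_entropy_wrt_annihilator [OF assms(2,3)] by (intro image_cong) auto
  then show ?thesis
    by (simp only: topological_adjoint_entropy_def algebraic_entropy_def
        open_finite_index_subgroups_eq_annihilators image_image)
qed

end
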